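(* Let $d>2$ be an integer, let $p_1,p_2\in[0,1]$, and let $W_{p_1},W_{p_2}:\mathcal{M}_d\to\mathcal{M}_d$ be the Werner maps with these parameters. The map $W_{p_1}\otimes(\vartheta_d\circ W_{p_2})$ is positive and non-decomposable if and only if both $$0\leq-\frac{(d+1-2p_1d)(d+1-2p_2d)}{(d+1-2p_1)(d+1-2p_2)}-\left(\frac{d+1-2p_1d}{d+1-2p_1}+\frac{d+1-2p_2d}{d+1-2p_2}\right)+2$$ and $$\frac{d-1}{d+1}p_1p_2+p_1(1-p_2)+(1-p_1)p_2-(1-p_1)(1-p_2)<0.$$
   Context: $\mathcal{M}_d$ denotes the complex $d\times d$ matrices and $\vartheta_d$ the transposition on $\mathcal{M}_d$ in the computational basis. A linear map is positive if it maps positive semidefinite matrices to positive semidefinite matrices. A linear map $L:\mathcal{M}_{D}\to\mathcal{M}_{D'}$ is decomposable if $L=T_1+\vartheta_{D'}\circ T_2$ with $T_1,T_2$ completely positive; here $\mathcal{M}_d\otimes\mathcal{M}_d\cong\mathcal{M}_{d^2}$. The Choi matrix of $L:\mathcal{M}_d\to\mathcal{M}_d$ is $C_L=(\mathrm{id}_d\otimes L)(\omega_d)$ with $\omega_d=\sum_{i,j}|i\rangle\langle j|\otimes|i\rangle\langle j|$. With the flip $\mathbb{F}_d(|i\rangle\otimes|j\rangle)=|j\rangle\otimes|i\rangle$, set $P_{\mathrm{sym}}=\frac12(\mathbb{1}_d\otimes\mathbb{1}_d+\mathbb{F}_d)$, $P_{\mathrm{asym}}=\frac12(\mathbb{1}_d\otimes\mathbb{1}_d-\mathbb{F}_d)$,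 $d_{\mathrm{sym}}=d(d+1)/2$, $d_{\mathrm{asym}}=d(d-1)/2$. The Werner map $W_p:\mathcal{M}_d\to\mathcal{M}_d$, $p\in[0,1]$, is the linear map with Choi matrix $C_{W_p}=\rho_W(p):=p\,P_{\mathrm{sym}}/d_{\mathrm{sym}}+(1-p)\,P_{\mathrm{asym}}/d_{\mathrm{asym}}$. *)

theory Defs
  imports Complex_Main "Jordan_Normal_Form.Matrix"
begin

text \<open>
  \<open>\<M>\<^sub>d\<close> is \<open>carrier_mat d d :: complex mat set\<close> with indices \<open>0, \<dots>, d - 1\<close>.
  The identification of \<open>\<M>\<^sub>a \<otimes> \<M>\<^sub>b\<close> with \<open>\<M>\<^bsub>ab\<^esub>\<close> sends the pair \<open>(i, k)\<close>, \<open>i < a\<close>, \<open>k < b\<close>,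
  to the index \<open>i * b + k\<close>.  A linear map on \<open>\<M>\<^sub>d\<close> is a function on \<open>complex mat\<close> of which only the
  restriction to the carrier matters.
\<close>

definition kron :: "complex mat \<Rightarrow> complex mat \<Rightarrow> complex mat" where
  "kron A B = mat (dim_row A * dim_row B) (dim_col A * dim_col B)
     (\<lambda>(r, c). A $$ (r div dim_row B, c div dim_col B) * B $$ (r mod dim_row B, c mod dim_col B))"

definition mat_unit :: "nat \<Rightarrow> nat \<Rightarrow> nat \<Rightarrow> complex mat" where
  "mat_unit d i j = mat d d (\<lambda>(r, c). if r = i \<and> c = j then 1 else 0)"

definition linear_map :: "nat \<Rightarrow> nat \<Rightarrow> (complex mat \<Rightarrow> complex mat) \<Rightarrow> bool" where
  "linear_map n m L \<longleftrightarrow>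
     (\<forall>X \<in> carrier_mat n n. L X \<in> carrier_mat m m) \<and>
     (\<forall>X \<in> carrier_mat n n. \<forall>Y \<in> carrier_mat n n. L (X + Y) = L X + L Y) \<and>
     (\<forall>c. \<forall>X \<in> carrier_mat n n. L (c \<cdot>\<^sub>m X) = c \<cdot>\<^sub>m L X)"

text \<open>
  The order on \<open>complex\<close> is the one of \<open>Complex_Order\<close>: \<open>0 \<le> z\<close> says that \<open>z\<close> is real and
  nonnegative, so that the condition below entails that \<open>A\<close> is Hermitian.
\<close>

definition psd :: "nat \<Rightarrow> complex mat \<Rightarrow> bool" where
  "psd n A \<longleftrightarrow> A \<in> carrier_mat n n \<and> (\<forall>v \<in> carrier_vec n. 0 \<le> (A *\<^sub>v v) \<bullet>c v)"

definition positive_map :: "nat \<Rightarrow> nat \<Rightarrow> (complex mat \<Rightarrow> complex mat) \<Rightarrow> bool" where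
  "positive_map n m L \<longleftrightarrow> linear_map n m L \<and> (\<forall>X. psd n X \<longrightarrow> psd m (L X))"

text \<open>
  \<open>tensor_map a a' b b' K L\<close> is \<open>K \<otimes> L : \<M>\<^bsub>ab\<^esub> \<rightarrow> \<M>\<^bsub>a'b'\<^esub>\<close> for linear \<open>K : \<M>\<^bsub>a\<^esub> \<rightarrow> \<M>\<^bsub>a'\<^esub>\<close> and
  \<open>L : \<M>\<^bsub>b\<^esub> \<rightarrow> \<M>\<^bsub>b'\<^esub>\<close>, obtained by expanding the argument in the basis \<open>E\<^bsub>ij\<^esub> \<otimes> E\<^bsub>kl\<^esub>\<close>; the
  sum is written entrywise because \<open>mat\<close> has no zero element independent of the dimension.
\<close>

definition tensor_map ::
  "nat \<Rightarrow> nat \<Rightarrow> nat \<Rightarrow> nat \<Rightarrow> (complex mat \<Rightarrow> complex mat) \<Rightarrow> (complex mat \<Rightarrow> complex mat) \<Rightarrow>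
   complex mat \<Rightarrow> complex mat" where
  "tensor_map a a' b b' K L X = mat (a' * b') (a' * b') (\<lambda>(r, c).
     \<Sum>i<a. \<Sum>j<a. \<Sum>k<b. \<Sum>l<b.
       X $$ (i * b + k, j * b + l) * kron (K (mat_unit a i j)) (L (mat_unit b k l)) $$ (r, c))"

definition completely_positive :: "nat \<Rightarrow> nat \<Rightarrow> (complex mat \<Rightarrow> complex mat) \<Rightarrow> bool" where
  "completely_positive n m T \<longleftrightarrow>
     linear_map n m T \<and> (\<forall>k. positive_map (k * n) (k * m) (tensor_map k k n m id T))"

definition decomposable :: "nat \<Rightarrow> nat \<Rightarrow> (complex mat \<Rightarrow> complex mat) \<Rightarrow> bool" where
  "decomposable n m L \<longleftrightarrow>
     (\<exists>T1 T2. completely_positive n m T1 \<and> completely_positive n m T2 \<and>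
        (\<forall>X \<in> carrier_mat n n. L X = T1 X + transpose_mat (T2 X)))"

text \<open>\<open>\<omega>\<^sub>d = \<Sum>\<^bsub>i,j\<^esub> |i\<rangle>\<langle>j| \<otimes> |i\<rangle>\<langle>j|\<close>.\<close>

definition omega_mat :: "nat \<Rightarrow> complex mat" where
  "omega_mat d = mat (d * d) (d * d) (\<lambda>(r, c).
     \<Sum>i<d. \<Sum>j<d. kron (mat_unit d i j) (mat_unit d i j) $$ (r, c))"

definition choi :: "nat \<Rightarrow> (complex mat \<Rightarrow> complex mat) \<Rightarrow> complex mat" where
  "choi d L = tensor_map d d d d id L (omega_mat d)"

text \<open>
  Column \<open>c\<close> of the flip is the image of \<open>|c div d\<rangle> \<otimes> |c mod d\<rangle>\<close>, that is,
  \<open>|c mod d\<rangle> \<otimes> |c div d\<rangle>\<close>.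
\<close>

definition flip_mat :: "nat \<Rightarrow> complex mat" where
  "flip_mat d = mat (d * d) (d * d) (\<lambda>(r, c). if r = (c mod d) * d + c div d then 1 else 0)"

definition P_sym :: "nat \<Rightarrow> complex mat" where
  "P_sym d = (1 / 2) \<cdot>\<^sub>m (kron (1\<^sub>m d) (1\<^sub>m d) + flip_mat d)"

definition P_asym :: "nat \<Rightarrow> complex mat" where
  "P_asym d = (1 / 2) \<cdot>\<^sub>m (kron (1\<^sub>m d) (1\<^sub>m d) - flip_mat d)"

definition d_sym :: "nat \<Rightarrow> real" where
  "d_sym d = real d * (real d + 1) / 2"

definition d_asym :: "nat \<Rightarrow> real" where
  "d_asym d = real d * (real d - 1) / 2"

definition werner_state :: "nat \<Rightarrow> real \<Rightarrow> complex mat" where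
  "werner_state d p =
     complex_of_real (p / d_sym d) \<cdot>\<^sub>m P_sym d + complex_of_real ((1 - p) / d_asym d) \<cdot>\<^sub>m P_asym d"

text \<open>
  The Werner map is specified by its Choi matrix.  Such a map exists and is unique on
  \<open>carrier_mat d d\<close>, see \<open>is_werner_map_exists\<close> and \<open>is_werner_map_unique\<close>.
\<close>

definition is_werner_map :: "nat \<Rightarrow> real \<Rightarrow> (complex mat \<Rightarrow> complex mat) \<Rightarrow> bool" where
  "is_werner_map d p W \<longleftrightarrow> linear_map d d W \<and> choi d W = werner_state d p"


lemma pair_index_less:
  fixes i k :: nat
  assumes "i < a" "k < b"
  shows "i * b + k < a * b"
proof -
  have "i * b + k < Suc i * b" using assms by simp
  also have "\<dots> \<le> a * b" using assms by (intro mult_le_mono1) simp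
  finally show ?thesis .
qed

lemma mat_unit_carrier [simp]: "mat_unit d i j \<in> carrier_mat d d"
  by (simp add: mat_unit_def)

lemma dim_mat_unit [simp]: "dim_row (mat_unit d i j) = d" "dim_col (mat_unit d i j) = d"
  by (simp_all add: mat_unit_def)

lemma index_mat_unit [simp]:
  "r < d \<Longrightarrow> c < d \<Longrightarrow> mat_unit d i j $$ (r, c) = (if r = i \<and> c = j then 1 else 0)"
  by (simp add: mat_unit_def)

lemma kron_carrier:
  assumes "A \<in> carrier_mat n n'" "B \<in> carrier_mat m m'"
  shows "kron A B \<in> carrier_mat (n * m) (n' * m')"
  using assms by (simp add: kron_def)

lemma index_kron:
  assumes "A \<in> carrier_mat n n'" "B \<in> carrier_mat m m'" "r < n * m" "c < n' * m'"
  shows "kron A B $$ (r, c) = A $$ (r div m, c div m') * B $$ (r mod m, c mod m')"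
  using assms by (simp add: kron_def)

lemma sum_delta2:
  fixes f :: "nat \<Rightarrow> nat \<Rightarrow> complex"
  assumes "r < n" "c < m"
  shows "(\<Sum>i<n. \<Sum>j<m. f i j * (if r = i \<and> c = j then 1 else 0)) = f r c"
proof -
  have "(\<Sum>j<m. f i j * (if r = i \<and> c = j then 1 else 0)) = (if i = r then f i c else 0)" for i
  proof (cases "i = r")
    case True
    have "(\<Sum>j<m. f i j * (if r = i \<and> c = j then 1 else 0)) = (\<Sum>j<m. if j = c then f i j else 0)"
      using True by (intro sum.cong) auto
    with True assms show ?thesis by simp
  qed auto
  with assms show ?thesis by simp
qed

lemma linear_map_entry_expand:
  assumes L: "linear_map n m L" and X: "X \<in> carrier_mat n n" and rc: "r < m" "c < m"
  shows "L X $$ (r, c) = (\<Sum>i<n. \<Sum>j<n. X $$ (i, j) * L (mat_unit n i j) $$ (r, c))"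
proof -
  define P where "P S = mat n n (\<lambda>ij. if ij \<in> S then X $$ ij else 0)" for S
  have Pc: "P S \<in> carrier_mat n n" for S by (simp add: P_def)
  have Lc: "Y \<in> carrier_mat n n \<Longrightarrow> L Y \<in> carrier_mat m m" for Y
    using L by (simp add: linear_map_def)
  have Ladd: "Y \<in> carrier_mat n n \<Longrightarrow> Z \<in> carrier_mat n n \<Longrightarrow> L (Y + Z) = L Y + L Z" for Y Z
    using L by (simp add: linear_map_def)
  have Lsm: "Y \<in> carrier_mat n n \<Longrightarrow> L (a \<cdot>\<^sub>m Y) = a \<cdot>\<^sub>m L Y" for a Y
    using L by (simp add: linear_map_def)
  have main: "finite S \<Longrightarrow> S \<subseteq> {..<n} \<times> {..<n} \<Longrightarrow>
      L (P S) $$ (r, c) = (\<Sum>(i, j)\<in>S. X $$ (i, j) * L (mat_unit n i j) $$ (r, c))" for S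
  proof (induction S rule: finite_induct)
    case empty
    have "P {} = 0 \<cdot>\<^sub>m P {}" by (rule eq_matI) (auto simp: P_def)
    then have "L (P {}) = 0 \<cdot>\<^sub>m L (P {})" using Lsm[OF Pc] by metis
    then have "L (P {}) $$ (r, c) = (0 \<cdot>\<^sub>m L (P {})) $$ (r, c)" by simp
    also have "\<dots> = 0" using Lc[OF Pc, of "{}"] rc by simp
    finally show ?case by simp
  next
    case (insert x S)
    obtain i j where x: "x = (i, j)" by fastforce
    with insert.prems have ij: "i < n" "j < n" by auto
    have "P (insert x S) = X $$ (i, j) \<cdot>\<^sub>m mat_unit n i j + P S"
      using insert.hyps x by (intro eq_matI) (auto simp: P_def mat_unit_def)
    then have "L (P (insert x S)) = X $$ (i, j) \<cdot>\<^sub>m L (mat_unit n i j) + L (P S)"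
      by (simp add: Ladd Lsm Pc)
    then show ?case
      using insert x rc Lc[OF Pc, of S] Lc[OF mat_unit_carrier, of i j] by simp
  qed
  have "P ({..<n} \<times> {..<n}) = X" using X by (intro eq_matI) (auto simp: P_def)
  with main[of "{..<n} \<times> {..<n}"] show ?thesis by (simp add: sum.cartesian_product)
qed

lemma tensor_map_kron:
  assumes K: "linear_map a a' K" and L: "linear_map b b' L"
    and A: "A \<in> carrier_mat a a" and B: "B \<in> carrier_mat b b"
  shows "tensor_map a a' b b' K L (kron A B) = kron (K A) (L B)"
proof (rule eq_matI)
  have KA: "K Y \<in> carrier_mat a' a'" if "Y \<in> carrier_mat a a" for Y
    using K that by (simp add: linear_map_def)
  have LB: "L Y \<in> carrier_mat b' b'" if "Y \<in> carrier_mat b b" for Y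
    using L that by (simp add: linear_map_def)
  fix r c assume "r < dim_row (kron (K A) (L B))" "c < dim_col (kron (K A) (L B))"
  then have rc: "r < a' * b'" "c < a' * b'" using kron_carrier[OF KA[OF A] LB[OF B]] by auto
  then have "b' > 0" by (auto intro: Nat.gr0I)
  then have bnd: "r div b' < a'" "c div b' < a'" "r mod b' < b'" "c mod b' < b'"
    using rc by (auto simp: less_mult_imp_div_less)
  have "tensor_map a a' b b' K L (kron A B) $$ (r, c) =
     (\<Sum>i<a. \<Sum>j<a. \<Sum>k<b. \<Sum>l<b. (A $$ (i, j) * K (mat_unit a i j) $$ (r div b', c div b')) *
        (B $$ (k, l) * L (mat_unit b k l) $$ (r mod b', c mod b')))"
    using rc unfolding tensor_map_def
    by (auto intro!: sum.cong
        simp: index_kron[OF A B] index_kron[OF KA LB] pair_index_less mult_ac)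
  also have "\<dots> = (\<Sum>i<a. \<Sum>j<a. A $$ (i, j) * K (mat_unit a i j) $$ (r div b', c div b')) *
      (\<Sum>k<b. \<Sum>l<b. B $$ (k, l) * L (mat_unit b k l) $$ (r mod b', c mod b'))"
    by (simp only: sum_distrib_right) (simp only: sum_distrib_left)
  also have "\<dots> = K A $$ (r div b', c div b') * L B $$ (r mod b', c mod b')"
    using linear_map_entry_expand[OF K A] linear_map_entry_expand[OF L B] bnd by simp
  also have "\<dots> = kron (K A) (L B) $$ (r, c)"
    using index_kron[OF KA[OF A] LB[OF B] rc] by simp
  finally show "tensor_map a a' b b' K L (kron A B) $$ (r, c) = kron (K A) (L B) $$ (r, c)" .
next
  have "kron (K A) (L B) \<in> carrier_mat (a' * b') (a' * b')"
    using K L A B by (intro kron_carrier) (auto simp: linear_map_def)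
  then show "dim_row (tensor_map a a' b b' K L (kron A B)) = dim_row (kron (K A) (L B))"
    "dim_col (tensor_map a a' b b' K L (kron A B)) = dim_col (kron (K A) (L B))"
    by (auto simp: tensor_map_def)
qed

lemma choi_carrier [simp]: "choi d L \<in> carrier_mat (d * d) (d * d)"
  by (simp add: choi_def tensor_map_def)

lemma index_omega_mat:
  assumes "i < d" "j < d" "k < d" "l < d"
  shows "omega_mat d $$ (i * d + k, j * d + l) = (if i = k \<and> j = l then 1 else 0)"
proof -
  have "omega_mat d $$ (i * d + k, j * d + l) =
      (\<Sum>i'<d. \<Sum>j'<d. (if k = i' \<and> l = j' then 1 else 0) * (if i = i' \<and> j = j' then 1 else 0))"
    using assms by (auto intro!: sum.cong
        simp: omega_mat_def index_kron[OF mat_unit_carrier mat_unit_carrier] pair_index_less)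
  also have "\<dots> = (if i = k \<and> j = l then 1 else 0)"
    using sum_delta2[OF assms(1,2), of "\<lambda>i' j'. if k = i' \<and> l = j' then 1 else 0"] by auto
  finally show ?thesis .
qed

lemma index_choi:
  assumes L: "linear_map d d L" and "i < d" "j < d" "k < d" "l < d"
  shows "choi d L $$ (i * d + k, j * d + l) = L (mat_unit d i j) $$ (k, l)"
proof -
  have Lc: "L (mat_unit d i j) \<in> carrier_mat d d" for i j
    using L by (simp add: linear_map_def)
  have "choi d L $$ (i * d + k, j * d + l) =
     (\<Sum>i'<d. \<Sum>j'<d. \<Sum>k'<d. \<Sum>l'<d.
        ((if i = i' \<and> j = j' then 1 else 0) * L (mat_unit d k' l') $$ (k, l)) *
        (if i' = k' \<and> j' = l' then 1 else 0))"
    using assms by (auto intro!: sum.cong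
        simp: choi_def tensor_map_def index_omega_mat
          index_kron[OF mat_unit_carrier Lc] pair_index_less)
  also have "\<dots> = (\<Sum>i'<d. \<Sum>j'<d. L (mat_unit d i' j') $$ (k, l) *
        (if i = i' \<and> j = j' then 1 else 0))"
    by (intro sum.cong refl) (simp add: sum_delta2 mult.commute)
  also have "\<dots> = L (mat_unit d i j) $$ (k, l)"
    using sum_delta2[OF assms(2,3), of "\<lambda>i' j'. L (mat_unit d i' j') $$ (k, l)"] by simp
  finally show ?thesis .
qed

lemma is_werner_map_exists: "\<exists>W. is_werner_map d p W"
proof -
  define W where "W X = mat d d (\<lambda>(k, l).
    \<Sum>i<d. \<Sum>j<d. X $$ (i, j) * werner_state d p $$ (i * d + k, j * d + l))" for X
  have lin: "linear_map d d W"
    unfolding linear_map_def W_def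
    by (auto intro!: eq_matI simp: sum.distrib distrib_right sum_distrib_left mult.assoc)
  have car: "werner_state d p \<in> carrier_mat (d * d) (d * d)"
    by (intro carrier_matI) (simp_all add: werner_state_def P_sym_def P_asym_def flip_mat_def)
  have "choi d W = werner_state d p"
  proof (rule eq_matI)
    fix r c assume "r < dim_row (werner_state d p)" "c < dim_col (werner_state d p)"
    with car have rc: "r < d * d" "c < d * d" by auto
    then have "d > 0" by (auto intro: Nat.gr0I)
    define i k j l where ijkl: "i = r div d" "k = r mod d" "j = c div d" "l = c mod d"
    have b: "i < d" "k < d" "j < d" "l < d"
      using rc \<open>d > 0\<close> by (auto simp: ijkl less_mult_imp_div_less)
    have rc': "r = i * d + k" "c = j * d + l" by (simp_all add: ijkl)
    have "choi d W $$ (r, c) = W (mat_unit d i j) $$ (k, l)"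
      unfolding rc' using index_choi[OF lin] b by simp
    also have "\<dots> = (\<Sum>i'<d. \<Sum>j'<d. werner_state d p $$ (i' * d + k, j' * d + l) *
        (if i = i' \<and> j = j' then 1 else 0))"
      unfolding W_def using b by (auto intro!: sum.cong)
    also have "\<dots> = werner_state d p $$ (r, c)"
      unfolding rc' using b by (simp add: sum_delta2)
    finally show "choi d W $$ (r, c) = werner_state d p $$ (r, c)" .
  qed (use car carrier_matD[OF choi_carrier[of d W]] in auto)
  with lin show ?thesis unfolding is_werner_map_def by blast
qed

lemma is_werner_map_unique:
  assumes "is_werner_map d p V" "is_werner_map d p W" "X \<in> carrier_mat d d"
  shows "V X = W X"
proof (rule eq_matI)
  have lin: "linear_map d d V" "linear_map d d W" and ch: "choi d V = choi d W"
    using assms by (auto simp: is_werner_map_def)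
  have car: "V X \<in> carrier_mat d d" "W X \<in> carrier_mat d d"
    using lin assms(3) by (auto simp: linear_map_def)
  then show "dim_row (V X) = dim_row (W X)" "dim_col (V X) = dim_col (W X)" by auto
  fix k l assume "k < dim_row (W X)" "l < dim_col (W X)"
  with car have kl: "k < d" "l < d" by auto
  have "V (mat_unit d i j) $$ (k, l) = W (mat_unit d i j) $$ (k, l)" if "i < d" "j < d" for i j
    using index_choi[OF lin(1) that kl] index_choi[OF lin(2) that kl] ch by simp
  then show "V X $$ (k, l) = W X $$ (k, l)"
    using linear_map_entry_expand[OF lin(1) assms(3) kl]
      linear_map_entry_expand[OF lin(2) assms(3) kl] by simp
qed

end

theory Submission
  imports Defs "HOL-Analysis.Convex"
begin

text \<open>
  Up to a positive factor \<open>W\<^sub>p\<close> is \<open>X \<mapsto> tr X 1 - q X\<^sup>T\<close> with \<open>q = (d + 1 - 2 p d) / (d + 1 - 2 p)\<close>, which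
  runs over \<open>[-1, 1]\<close>.  The two inequalities then read \<open>(1 + q\<^sub>1) (1 + q\<^sub>2) \<le> 3\<close> (positivity) and
  \<open>(1 + q\<^sub>1) (1 + q\<^sub>2) > 2 + 2 / d\<close> (non-decomposability).

  On rank one arguments \<open>A\<close> and test vectors \<open>B\<close> the form of the map is
  \<open>u - q\<^sub>1 x - q\<^sub>2 y + q\<^sub>1 q\<^sub>2 t\<close> with \<open>u = \<parallel>A\<parallel>\<^sup>2 \<parallel>B\<parallel>\<^sup>2\<close>.  It is decreasing in each \<open>q\<^sub>i\<close> and concave along
  the curve \<open>(1 + q\<^sub>1) (1 + q\<^sub>2) = 3\<close>, so positivity reduces to the corners \<open>(1, 1/2)\<close> and \<open>(1/2, 1)\<close>,
  where it follows from \<open>|tr M|\<^sup>2 \<le> 2 \<parallel>M\<parallel>\<^sup>2\<close> for matrices \<open>M\<close> of rank at most two.  Decomposability is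
  a linear problem in the algebra spanned by \<open>1, F, \<Omega>, F \<otimes> \<Omega>\<close>, settled by an explicit decomposition
  and an explicit PPT witness.
\<close>

section \<open>Positive semidefinite kernels\<close>

text \<open>Kernels on arbitrary index sets replace matrices so that tuples can serve as indices;
  flat matrix indices appear only in the translation to \<open>psd\<close>.\<close>

definition qform :: "'a set \<Rightarrow> ('a \<Rightarrow> 'a \<Rightarrow> complex) \<Rightarrow> ('a \<Rightarrow> complex) \<Rightarrow> complex" where
  "qform S M v = (\<Sum>a\<in>S. \<Sum>b\<in>S. cnj (v a) * M a b * v b)"

definition psd_kernel :: "'a set \<Rightarrow> ('a \<Rightarrow> 'a \<Rightarrow> complex) \<Rightarrow> bool" where
  "psd_kernel S M \<longleftrightarrow> (\<forall>v. 0 \<le> qform S M v)"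

lemma psd_kernel_subset:
  fixes T :: "'a set"
  assumes "psd_kernel T M" "finite T" "S \<subseteq> T"
  shows "psd_kernel S M"
  unfolding psd_kernel_def
proof
  fix v :: "'a \<Rightarrow> complex"
  define w where "w a = (if a \<in> S then v a else 0)" for a
  have "qform T M w = (\<Sum>a\<in>S. \<Sum>b\<in>T. cnj (w a) * M a b * w b)"
    unfolding qform_def using assms by (intro sum.mono_neutral_right) (auto simp: w_def)
  also have "\<dots> = (\<Sum>a\<in>S. \<Sum>b\<in>S. cnj (w a) * M a b * w b)"
    using assms by (intro sum.cong refl sum.mono_neutral_right) (auto simp: w_def)
  also have "\<dots> = qform S M v" unfolding qform_def by (simp add: w_def)
  finally show "0 \<le> qform S M v" using assms(1) by (metis psd_kernel_def)
qed

lemma psd_kernel_reindex: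
  fixes h :: "'a \<Rightarrow> 'b"
  assumes "inj_on h S" "psd_kernel (h ` S) M"
  shows "psd_kernel S (\<lambda>a b. M (h a) (h b))"
  unfolding psd_kernel_def
proof
  fix v :: "'a \<Rightarrow> complex"
  define w where "w = v \<circ> the_inv_into S h"
  have "w (h a) = v a" if "a \<in> S" for a
    using that assms(1) by (simp add: w_def the_inv_into_f_f)
  then have "qform (h ` S) M w = qform S (\<lambda>a b. M (h a) (h b)) v"
    using assms(1) by (simp add: qform_def sum.reindex)
  then show "0 \<le> qform S (\<lambda>a b. M (h a) (h b)) v"
    using assms(2) by (metis psd_kernel_def)
qed

lemma psd_kernel_diag:
  assumes "psd_kernel T M" "finite T" "a \<in> T"
  shows "0 \<le> M a a"
proof -
  have "psd_kernel {a} M" using assms by (auto intro: psd_kernel_subset)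
  then have "0 \<le> qform {a} M (\<lambda>_. 1)" by (simp only: psd_kernel_def)
  then show ?thesis by (simp add: qform_def)
qed

lemma psd_kernel_pair:
  assumes "psd_kernel T M" "finite T" "a \<in> T" "b \<in> T" "a \<noteq> b"
  shows "0 \<le> cnj s * M a a * s + cnj s * M a b * t + (cnj t * M b a * s + cnj t * M b b * t)"
proof -
  have "psd_kernel {a, b} M" using assms by (auto intro: psd_kernel_subset)
  then have "0 \<le> qform {a, b} M (\<lambda>x. if x = a then s else t)" by (simp only: psd_kernel_def)
  then show ?thesis using assms(5) by (auto simp: qform_def)
qed

lemma psd_kernel_hermitian:
  assumes "psd_kernel T M" "finite T" "a \<in> T" "b \<in> T"
  shows "M b a = cnj (M a b)"
proof -
  have d: "0 \<le> M a a" "0 \<le> M b b" using psd_kernel_diag assms by metis+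
  show ?thesis
  proof (cases "a = b")
    case False
    \<comment> \<open>The form and the diagonal are real, so the test vectors \<open>(1, 1)\<close>
      and \<open>(1, \<i>)\<close> force \<open>Im (M a b + M b a)\<close> and
      \<open>Re (M a b - M b a)\<close> to vanish.\<close>
    note * = psd_kernel_pair[OF assms False]
    show ?thesis using *[of 1 1] *[of 1 \<i>] d
      by (simp add: less_eq_complex_def complex_eq_iff)
  qed (use d in \<open>simp add: less_eq_complex_def complex_eq_iff\<close>)
qed

text \<open>On test vectors with entries \<open>- l * M a b\<close> at \<open>a\<close> and
  \<open>1\<close> at \<open>b\<close> the form is affine in \<open>l\<close> with slope
  \<open>- 2 * r\<close>, so a nonzero entry would make it negative for large
  \<open>l\<close>.\<close>

lemma psd_kernel_zero_row:
  assumes "psd_kernel T M" "finite T" "a \<in> T" "b \<in> T" "M a a = 0"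
  shows "M a b = 0"
proof (cases "a = b")
  case False
  define r where "r = (cmod (M a b))\<^sup>2"
  have h: "M b a = cnj (M a b)" using psd_kernel_hermitian assms(1-4) by metis
  have r: "M a b * cnj (M a b) = of_real r" by (simp only: r_def complex_norm_square)
  have "0 \<le> Re (M b b) - 2 * l * r" for l :: real
  proof -
    have "cnj (- of_real l * M a b) * M a b * 1 = of_real (- l * r)"
      "cnj 1 * M b a * (- of_real l * M a b) = of_real (- l * r)"
      using r by (simp_all add: h mult_ac)
    note this[unfolded mult.assoc]
    moreover have "0 \<le> cnj (- of_real l * M a b) * M a b * 1
        + (cnj 1 * M b a * (- of_real l * M a b) + cnj 1 * M b b * 1)"
      using psd_kernel_pair[OF assms(1-4) False, of "- of_real l * M a b" 1] unfolding assms(5)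
      by (simp only: mult_zero_left mult_zero_right add_0)
    ultimately show ?thesis by (simp only: mult.assoc) (simp add: less_eq_complex_def)
  qed
  from this[of "(Re (M b b) + 1) / r"] have "r = 0"
    by (cases "r = 0") (use psd_kernel_diag[OF assms(1,2,4)] in \<open>auto simp: less_eq_complex_def\<close>)
  then show ?thesis by (simp add: r_def)
qed (use assms in simp)

lemma qform_insert:
  assumes "finite S" "x \<notin> S"
  shows "qform (insert x S) M v = cnj (v x) * M x x * v x + cnj (v x) * (\<Sum>b\<in>S. M x b * v b)
    + (\<Sum>a\<in>S. cnj (v a) * M a x) * v x + qform S M v"
  using assms by (simp add: qform_def sum.distrib sum_distrib_left sum_distrib_right mult_ac)

text \<open>Cholesky decomposition: split off the rank one part of a row, the Schur complement stays psd.\<close>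

lemma psd_kernel_gram:
  assumes "finite S" "psd_kernel S M"
  shows "\<exists>K. \<forall>a\<in>S. \<forall>b\<in>S. M a b = (\<Sum>m\<in>S. K m a * cnj (K m b))"
  using assms
proof (induction S arbitrary: M rule: finite_induct)
  case (insert x S)
  let ?T = "insert x S"
  have fT: "finite ?T" using insert by simp
  define m where "m = Re (M x x)"
  have m: "M x x = of_real m" "0 \<le> m"
    using psd_kernel_diag[OF insert.prems fT, of x] by (auto simp: less_eq_complex_def complex_eq_iff m_def)
  have herm: "M b a = cnj (M a b)" if "a \<in> ?T" "b \<in> ?T" for a b
    using psd_kernel_hermitian[OF insert.prems fT] that by blast
  \<comment> \<open>Since \<open>x / 0 = 0\<close>, the case \<open>m = 0\<close> gives
    \<open>N = M\<close>; row and column \<open>x\<close> then vanish by \<open>row\<close>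
    below.\<close>
  define N where "N a b = M a b - M a x * M x b / of_real m" for a b
  have "psd_kernel S N"
    unfolding psd_kernel_def
  proof
    fix v
    define w where "w = (\<Sum>b\<in>S. M x b * v b)"
    have w': "(\<Sum>a\<in>S. cnj (v a) * M a x) = cnj w"
      unfolding w_def cnj_sum using herm[of x] by (intro sum.cong) (auto simp: mult_ac)
    have N: "qform S N v = qform S M v - cnj w * w / of_real m"
    proof -
      have "cnj w * w = (\<Sum>a\<in>S. \<Sum>b\<in>S. cnj (v a) * (M a x * M x b) * v b)"
        unfolding w'[symmetric] unfolding w_def sum_product by (simp add: mult_ac)
      then show ?thesis
        by (simp add: qform_def N_def right_diff_distrib left_diff_distrib sum_subtractf
            sum_divide_distrib)
    qed
    \<comment> \<open>For \<open>m > 0\<close> this coordinate at \<open>x\<close> minimises the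
      form, and the minimum is the form of the Schur complement.\<close>
    define v' where "v' = v(x := - w / of_real m)"
    have "(\<Sum>b\<in>S. M x b * v' b) = w" "(\<Sum>a\<in>S. cnj (v' a) * M a x) = cnj w" "qform S M v' = qform S M v"
    proof -
      have "v' a = v a" if "a \<in> S" for a using that insert.hyps by (auto simp: v'_def)
      then show "(\<Sum>b\<in>S. M x b * v' b) = w" "(\<Sum>a\<in>S. cnj (v' a) * M a x) = cnj w"
        "qform S M v' = qform S M v"
        unfolding w'[symmetric] unfolding w_def qform_def by simp_all
    qed
    then have "qform ?T M v' = qform S N v"
      using insert.hyps by (cases "m = 0") (simp_all add: qform_insert N v'_def m field_simps)
    then show "0 \<le> qform S N v" using insert.prems by (metis psd_kernel_def)
  qed
  from insert.IH[OF this] obtain K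
    where K: "\<And>a b. a \<in> S \<Longrightarrow> b \<in> S \<Longrightarrow> N a b = (\<Sum>m\<in>S. K m a * cnj (K m b))" by blast
  \<comment> \<open>The new Gram vector is column \<open>x\<close> divided by \<open>sqrt m\<close>;
    those of the Schur complement are extended by 0 at \<open>x\<close>.\<close>
  define K' where "K' k a = (if k = x then M a x / of_real (sqrt m) else if a = x then 0 else K k a)"
    for k a
  have row: "M x a = 0" "M a x = 0" if "m = 0" "a \<in> ?T" for a
    using psd_kernel_zero_row[OF insert.prems fT, of x a] herm[of x a] that m by auto
  have sq: "complex_of_real (sqrt m) * of_real (sqrt m) = of_real m"
    using m by (metis of_real_mult real_sqrt_mult_self abs_of_nonneg)
  have "M a b = (\<Sum>k\<in>?T. K' k a * cnj (K' k b))" if ab: "a \<in> ?T" "b \<in> ?T" for a b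
  proof -
    have "(\<Sum>k\<in>?T. K' k a * cnj (K' k b)) = M a x * M x b / of_real m + (\<Sum>k\<in>S. K' k a * cnj (K' k b))"
      using insert.hyps herm[of x b] herm[of b x] ab sq by (simp add: K'_def)
    also have "(\<Sum>k\<in>S. K' k a * cnj (K' k b)) = (if a = x \<or> b = x then 0 else N a b)"
      using insert.hyps K[of a b] ab by (auto simp: K'_def intro!: sum.neutral sum.cong)
    also have "M a x * M x b / of_real m + \<dots> = M a b"
      using m row[of a] row[of b] ab by (cases "m = 0") (auto simp: N_def)
    finally show ?thesis by simp
  qed
  then show ?case by blast
qed simp

section \<open>Quadratic forms on four tensor factors\<close>

lemma cmod_sum_squared_le:
  fixes f :: "nat \<Rightarrow> complex"
  shows "(cmod (\<Sum>k<d. f k))\<^sup>2 \<le> real d * (\<Sum>k<d. (cmod (f k))\<^sup>2)"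
proof -
  have "(cmod (\<Sum>k<d. f k))\<^sup>2 \<le> (\<Sum>k<d. cmod (f k))\<^sup>2"
    by (intro power_mono norm_sum) simp
  also have "\<dots> \<le> (\<Sum>k<d. (cmod (f k))\<^sup>2) * real (card {..<d})"
    by (rule sum_squared_le_sum_of_squares)
  finally show ?thesis by (simp add: mult.commute)
qed

lemma cmod_sum_mult_squared_le:
  fixes f g :: "nat \<Rightarrow> complex"
  shows "(cmod (\<Sum>k<d. f k * g k))\<^sup>2 \<le> (\<Sum>k<d. (cmod (f k))\<^sup>2) * (\<Sum>k<d. (cmod (g k))\<^sup>2)"
proof -
  have "(cmod (\<Sum>k<d. f k * g k))\<^sup>2 \<le> (\<Sum>k<d. cmod (f k) * cmod (g k))\<^sup>2"
    by (intro power_mono order_trans[OF norm_sum]) (simp_all add: norm_mult)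
  also have "\<dots> \<le> (\<Sum>k<d. (cmod (f k))\<^sup>2) * (\<Sum>k<d. (cmod (g k))\<^sup>2)"
    by (rule Cauchy_Schwarz_ineq_sum)
  finally show ?thesis .
qed

lemma cmod_add_squared:
  "(cmod (x + y))\<^sup>2 = (cmod x)\<^sup>2 + (cmod y)\<^sup>2 + 2 * Re (cnj x * y)"
  by (simp only: cmod_power2) (simp add: power2_eq_square algebra_simps)

lemma cmod_diff_squared:
  "(cmod (x - y))\<^sup>2 = (cmod x)\<^sup>2 + (cmod y)\<^sup>2 - 2 * Re (cnj x * y)"
  by (simp only: cmod_power2) (simp add: power2_eq_square algebra_simps)

text \<open>Orthogonality removes the cross terms of the Frobenius norm, leaving
  \<open>N p * N q + N r * N s\<close>. The trace is then controlled by
  \<open>(x + y)\<^sup>2 \<le> 2 * (x\<^sup>2 + y\<^sup>2)\<close> and Cauchy-Schwarz on each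
  summand.\<close>

lemma trace_rank_two_squared_le_orth:
  fixes p q r s :: "nat \<Rightarrow> complex"
  assumes orth: "(\<Sum>k<d. cnj (p k) * r k) = 0"
  shows "(cmod (\<Sum>k<d. p k * q k - r k * s k))\<^sup>2
    \<le> 2 * (\<Sum>k<d. \<Sum>l<d. (cmod (p k * q l - r k * s l))\<^sup>2)"
proof -
  define N where "N f = (\<Sum>k<d. (cmod (f k))\<^sup>2)" for f :: "nat \<Rightarrow> complex"
  have "(\<Sum>k<d. \<Sum>l<d. cnj (p k * q l) * (r k * s l))
      = (\<Sum>k<d. cnj (p k) * r k) * (\<Sum>l<d. cnj (q l) * s l)"
    unfolding sum_product by (simp add: mult_ac)
  then have "Re (\<Sum>k<d. \<Sum>l<d. cnj (p k * q l) * (r k * s l)) = 0"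
    using orth by simp
  then have "(\<Sum>k<d. \<Sum>l<d. Re (cnj (p k * q l) * (r k * s l))) = 0"
    by (simp only: Re_sum)
  then have "(\<Sum>k<d. \<Sum>l<d. (cmod (p k * q l - r k * s l))\<^sup>2)
      = (\<Sum>k<d. \<Sum>l<d. (cmod (p k * q l))\<^sup>2) + (\<Sum>k<d. \<Sum>l<d. (cmod (r k * s l))\<^sup>2)"
    unfolding cmod_diff_squared sum_subtractf sum.distrib sum_distrib_left[symmetric] by simp
  also have "\<dots> = N p * N q + N r * N s"
    unfolding N_def sum_product by (simp add: norm_mult power_mult_distrib)
  finally have rhs: "(\<Sum>k<d. \<Sum>l<d. (cmod (p k * q l - r k * s l))\<^sup>2) = N p * N q + N r * N s" .
  have "(cmod (\<Sum>k<d. p k * q k - r k * s k))\<^sup>2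
      \<le> (cmod (\<Sum>k<d. p k * q k) + cmod (\<Sum>k<d. r k * s k))\<^sup>2"
    by (intro power_mono) (simp_all add: sum_subtractf norm_triangle_ineq4)
  also have "\<dots> \<le> 2 * ((cmod (\<Sum>k<d. p k * q k))\<^sup>2 + (cmod (\<Sum>k<d. r k * s k))\<^sup>2)"
    using zero_le_power2[of "cmod (\<Sum>k<d. p k * q k) - cmod (\<Sum>k<d. r k * s k)"]
    by (simp add: power2_eq_square algebra_simps)
  also have "\<dots> \<le> 2 * (N p * N q + N r * N s)"
    unfolding N_def using cmod_sum_mult_squared_le[of p q d] cmod_sum_mult_squared_le[of r s d] by simp
  finally show ?thesis using rhs by simp
qed

text \<open>
  The matrix \<open>p q\<^sup>T - r s\<^sup>T\<close> has rank at most two, so its trace is controlled by the Frobenius norm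
  with constant 2.  Subtracting from \<open>r\<close> its projection onto \<open>p\<close> reduces to orthogonal \<open>p, r\<close>.
\<close>

lemma trace_rank_two_squared_le:
  fixes p q r s :: "nat \<Rightarrow> complex"
  shows "(cmod (\<Sum>k<d. p k * q k - r k * s k))\<^sup>2
    \<le> 2 * (\<Sum>k<d. \<Sum>l<d. (cmod (p k * q l - r k * s l))\<^sup>2)"
proof -
  define n where "n = (\<Sum>k<d. cnj (p k) * p k)"
  define c where "c = (\<Sum>k<d. cnj (p k) * r k) / n"
  \<comment> \<open>Moving \<open>c * p k * s l\<close> from one rank one term to the other keeps
    the matrix and makes \<open>r'\<close> orthogonal to \<open>p\<close>.\<close>
  define r' q' where "r' k = r k - c * p k" and "q' k = q k - c * s k" for k
  have n: "n = of_real (\<Sum>k<d. (cmod (p k))\<^sup>2)"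
    unfolding n_def of_real_sum complex_norm_square by (simp add: mult.commute)
  have "p k = 0" if "n = 0" "k < d" for k
  proof -
    have "(\<Sum>k<d. (cmod (p k))\<^sup>2) = 0" using n that(1) of_real_eq_0_iff by metis
    then show ?thesis using that(2) by (simp add: sum_nonneg_eq_0_iff)
  qed
  then have "c * n = (\<Sum>k<d. cnj (p k) * r k)"
    by (cases "n = 0") (auto simp: c_def intro!: sum.neutral)
  then have "(\<Sum>k<d. cnj (p k) * r' k) = 0"
    by (simp add: r'_def n_def right_diff_distrib sum_subtractf sum_distrib_left mult_ac)
  from trace_rank_two_squared_le_orth[OF this, of q' s]
  have "(cmod (\<Sum>k<d. p k * q' k - r' k * s k))\<^sup>2
      \<le> 2 * (\<Sum>k<d. \<Sum>l<d. (cmod (p k * q' l - r' k * s l))\<^sup>2)" .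
  moreover have "p k * q' l - r' k * s l = p k * q l - r k * s l" for k l
    by (simp add: r'_def q'_def algebra_simps)
  ultimately show ?thesis by simp
qed

text \<open>
  The vectors \<open>v i k r s\<close> live in \<open>(\<complex>\<^sup>d)\<^sup>\<otimes>\<^sup>4\<close>, with input \<open>(i, k)\<close> and output \<open>(r, s)\<close>.
  With \<open>F\<close> the flip on the first input and output factor and \<open>\<Omega> = \<omega>\<^sub>d\<close> on the second ones, the four
  forms below are the expectations of \<open>1\<close>, \<open>F\<close>, \<open>\<Omega>\<close> and \<open>F \<otimes> \<Omega>\<close> in \<open>v\<close>.
\<close>

type_synonym vec4 = "nat \<Rightarrow> nat \<Rightarrow> nat \<Rightarrow> nat \<Rightarrow> complex"

definition contr :: "nat \<Rightarrow> vec4 \<Rightarrow> nat \<Rightarrow> nat \<Rightarrow> complex" where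
  "contr d v i r = (\<Sum>k<d. v i k r k)"

definition form_1 :: "nat \<Rightarrow> vec4 \<Rightarrow> real" where
  "form_1 d v = (\<Sum>i<d. \<Sum>k<d. \<Sum>r<d. \<Sum>s<d. (cmod (v i k r s))\<^sup>2)"

definition form_F :: "nat \<Rightarrow> vec4 \<Rightarrow> complex" where
  "form_F d v = (\<Sum>i<d. \<Sum>k<d. \<Sum>r<d. \<Sum>s<d. cnj (v i k r s) * v r k i s)"

definition form_O :: "nat \<Rightarrow> vec4 \<Rightarrow> real" where
  "form_O d v = (\<Sum>i<d. \<Sum>r<d. (cmod (contr d v i r))\<^sup>2)"

definition form_FO :: "nat \<Rightarrow> vec4 \<Rightarrow> complex" where
  "form_FO d v = (\<Sum>i<d. \<Sum>r<d. cnj (contr d v i r) * contr d v r i)"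

section \<open>Inequalities between the four expectations in arbitrary vectors\<close>

lemma sum4_swap13:
  "(\<Sum>i<d. \<Sum>k<d. \<Sum>r<d. \<Sum>s<d. f i k r s) = (\<Sum>i<(d::nat). \<Sum>k<d. \<Sum>r<d. \<Sum>s<d. f r k i s)"
proof -
  have "(\<Sum>i<d. \<Sum>k<d. \<Sum>r<d. \<Sum>s<d. f i k r s) = (\<Sum>k<d. \<Sum>i<d. \<Sum>r<d. \<Sum>s<d. f i k r s)"
    by (rule sum.swap)
  also have "\<dots> = (\<Sum>k<d. \<Sum>r<d. \<Sum>i<d. \<Sum>s<d. f i k r s)"
    by (intro sum.cong refl sum.swap)
  also have "\<dots> = (\<Sum>i<d. \<Sum>k<d. \<Sum>r<d. \<Sum>s<d. f r k i s)"
    by (rule sum.swap)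
  finally show ?thesis .
qed

lemma form_F_real: "Im (form_F d v) = 0"
proof -
  have "cnj (form_F d v) = form_F d v"
    unfolding form_F_def cnj_sum by (subst sum4_swap13) (simp add: mult.commute)
  then show ?thesis by (simp add: complex_eq_iff)
qed

lemma form_FO_real: "Im (form_FO d v) = 0"
proof -
  have "cnj (form_FO d v) = form_FO d v"
    unfolding form_FO_def cnj_sum by (subst sum.swap) (simp add: mult.commute)
  then show ?thesis by (simp add: complex_eq_iff)
qed

text \<open>\<open>F\<close> is a self-adjoint involution, so the squared norm of
  \<open>v \<plusminus> F v\<close> is twice the expectation of
  \<open>1 \<plusminus> F\<close>.\<close>

lemma form_1_F:
  "(\<Sum>i<d. \<Sum>k<d. \<Sum>r<d. \<Sum>s<d. (cmod (v i k r s + v r k i s))\<^sup>2) = 2 * (form_1 d v + Re (form_F d v))"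
  "(\<Sum>i<d. \<Sum>k<d. \<Sum>r<d. \<Sum>s<d. (cmod (v i k r s - v r k i s))\<^sup>2) = 2 * (form_1 d v - Re (form_F d v))"
proof -
  have *: "(\<Sum>i<d. \<Sum>k<d. \<Sum>r<d. \<Sum>s<d. (cmod (v r k i s))\<^sup>2) = form_1 d v"
    unfolding form_1_def by (rule sum4_swap13[symmetric])
  show "(\<Sum>i<d. \<Sum>k<d. \<Sum>r<d. \<Sum>s<d. (cmod (v i k r s + v r k i s))\<^sup>2)
      = 2 * (form_1 d v + Re (form_F d v))"
    unfolding cmod_add_squared
    by (simp add: sum.distrib * Re_sum form_F_def sum_distrib_left[symmetric] del: times_complex.sel)
      (simp add: form_1_def)
  show "(\<Sum>i<d. \<Sum>k<d. \<Sum>r<d. \<Sum>s<d. (cmod (v i k r s - v r k i s))\<^sup>2)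
      = 2 * (form_1 d v - Re (form_F d v))"
    unfolding cmod_diff_squared
    by (simp add: sum.distrib sum_subtractf * Re_sum form_F_def sum_distrib_left[symmetric] del: times_complex.sel)
      (simp add: form_1_def)
qed

text \<open>The same expansion after contraction, where \<open>F\<close> acts as
  transposition.\<close>

lemma form_O_FO:
  "(\<Sum>i<d. \<Sum>r<d. (cmod (contr d v i r + contr d v r i))\<^sup>2) = 2 * (form_O d v + Re (form_FO d v))"
  "(\<Sum>i<d. \<Sum>r<d. (cmod (contr d v i r - contr d v r i))\<^sup>2) = 2 * (form_O d v - Re (form_FO d v))"
proof -
  have *: "(\<Sum>i<d. \<Sum>r<d. (cmod (contr d v r i))\<^sup>2) = form_O d v"
    unfolding form_O_def by (rule sum.swap)
  show "(\<Sum>i<d. \<Sum>r<d. (cmod (contr d v i r + contr d v r i))\<^sup>2) = 2 * (form_O d v + Re (form_FO d v))"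
    unfolding cmod_add_squared
    by (simp add: sum.distrib * Re_sum form_FO_def sum_distrib_left[symmetric] del: times_complex.sel)
      (simp add: form_O_def)
  show "(\<Sum>i<d. \<Sum>r<d. (cmod (contr d v i r - contr d v r i))\<^sup>2) = 2 * (form_O d v - Re (form_FO d v))"
    unfolding cmod_diff_squared
    by (simp add: sum.distrib sum_subtractf * Re_sum form_FO_def sum_distrib_left[symmetric] del: times_complex.sel)
      (simp add: form_O_def)
qed

lemma form_O_FO_nonneg:
  "0 \<le> form_O d v + Re (form_FO d v)" "0 \<le> form_O d v - Re (form_FO d v)"
proof -
  have "0 \<le> 2 * (form_O d v + Re (form_FO d v))" "0 \<le> 2 * (form_O d v - Re (form_FO d v))"
    unfolding form_O_FO[symmetric] by (simp_all add: sum_nonneg)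
  then show "0 \<le> form_O d v + Re (form_FO d v)" "0 \<le> form_O d v - Re (form_FO d v)" by simp_all
qed

text \<open>This is the bound of \<Omega> by its largest eigenvalue \<open>d\<close>: Cauchy-Schwarz
  over the \<open>d\<close> contracted entries.\<close>

lemma contr_squared_le:
  "(\<Sum>i<d. \<Sum>r<d. (cmod (contr d u i r))\<^sup>2)
    \<le> real d * (\<Sum>i<d. \<Sum>k<d. \<Sum>r<d. \<Sum>s<d. (cmod (u i k r s))\<^sup>2)"
proof -
  have "(\<Sum>i<d. \<Sum>r<d. (cmod (contr d u i r))\<^sup>2)
      \<le> (\<Sum>i<d. \<Sum>r<d. real d * (\<Sum>k<d. (cmod (u i k r k))\<^sup>2))"
    unfolding contr_def by (intro sum_mono cmod_sum_squared_le)
  also have "\<dots> \<le> (\<Sum>i<d. \<Sum>r<d. real d * (\<Sum>k<d. \<Sum>s<d. (cmod (u i k r s))\<^sup>2))"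
  proof (intro sum_mono mult_left_mono)
    fix i r k assume "k \<in> {..<d}"
    then show "(cmod (u i k r k))\<^sup>2 \<le> (\<Sum>s<d. (cmod (u i k r s))\<^sup>2)"
      by (intro member_le_sum) auto
  qed simp
  also have "\<dots> = real d * (\<Sum>i<d. \<Sum>r<d. \<Sum>k<d. \<Sum>s<d. (cmod (u i k r s))\<^sup>2)"
    by (simp add: sum_distrib_left)
  also have "(\<Sum>i<d. \<Sum>r<d. \<Sum>k<d. \<Sum>s<d. (cmod (u i k r s))\<^sup>2)
      = (\<Sum>i<d. \<Sum>k<d. \<Sum>r<d. \<Sum>s<d. (cmod (u i k r s))\<^sup>2)"
    by (intro sum.cong refl sum.swap)
  finally show ?thesis .
qed

text \<open>Contraction commutes with \<open>F\<close>, so the bound applied to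
  \<open>v \<plusminus> F v\<close> gives nonnegative expectations of
  \<open>(1 \<plusminus> F) (d - \<Omega>)\<close>.\<close>

lemma form_contr_le:
  "0 \<le> d * (form_1 d v + Re (form_F d v)) - (form_O d v + Re (form_FO d v))"
  "0 \<le> d * (form_1 d v - Re (form_F d v)) - (form_O d v - Re (form_FO d v))"
proof -
  have c: "contr d (\<lambda>i k r s. v i k r s + v r k i s) i r = contr d v i r + contr d v r i"
    "contr d (\<lambda>i k r s. v i k r s - v r k i s) i r = contr d v i r - contr d v r i" for i r
    by (simp_all add: contr_def sum.distrib sum_subtractf)
  have "2 * (form_O d v + Re (form_FO d v)) \<le> d * (2 * (form_1 d v + Re (form_F d v)))"
    "2 * (form_O d v - Re (form_FO d v)) \<le> d * (2 * (form_1 d v - Re (form_F d v)))"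
    using contr_squared_le[of d "\<lambda>i k r s. v i k r s + v r k i s"]
      contr_squared_le[of d "\<lambda>i k r s. v i k r s - v r k i s"]
    unfolding c form_1_F form_O_FO by simp_all
  then show "0 \<le> d * (form_1 d v + Re (form_F d v)) - (form_O d v + Re (form_FO d v))"
    "0 \<le> d * (form_1 d v - Re (form_F d v)) - (form_O d v - Re (form_FO d v))"
    by (simp_all only: mult.left_commute[of "real d" 2]) simp_all
qed

lemma form_1_F_nonneg:
  "0 \<le> form_1 d v + Re (form_F d v)" "0 \<le> form_1 d v - Re (form_F d v)"
proof -
  have "0 \<le> 2 * (form_1 d v + Re (form_F d v))" "0 \<le> 2 * (form_1 d v - Re (form_F d v))"
    unfolding form_1_F[symmetric] by (simp_all add: sum_nonneg)
  then show "0 \<le> form_1 d v + Re (form_F d v)" "0 \<le> form_1 d v - Re (form_F d v)" by simp_all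
qed

text \<open>The conjugate comes from the Choi convention: testing the image of the rank one input
  given by \<open>A\<close> against \<open>B\<close> is the Choi form at this product
  vector.\<close>

definition prod4 :: "(nat \<Rightarrow> nat \<Rightarrow> complex) \<Rightarrow> (nat \<Rightarrow> nat \<Rightarrow> complex) \<Rightarrow> vec4" where
  "prod4 A B i k r s = cnj (A i k) * B r s"

text \<open>For fixed \<open>i\<close> and \<open>r\<close> the antisymmetrised vector is a matrix
  of rank at most two in \<open>(k, s)\<close> with trace
  \<open>contr d w i r - contr d w r i\<close>. Summing the trace bound gives positivity at the
  corner \<open>(q1, q2) = (1, 1/2)\<close>.\<close>

lemma form_prod4_ineq:
  fixes A B :: "nat \<Rightarrow> nat \<Rightarrow> complex"
  defines "w \<equiv> prod4 A B"
  shows "0 \<le> 2 * form_1 d w - 2 * Re (form_F d w) - form_O d w + Re (form_FO d w)"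
proof -
  have "(\<Sum>i<d. \<Sum>r<d. (cmod (contr d w i r - contr d w r i))\<^sup>2)
      \<le> (\<Sum>i<d. \<Sum>r<d. 2 * (\<Sum>k<d. \<Sum>s<d. (cmod (w i k r s - w r k i s))\<^sup>2))"
  proof (intro sum_mono)
    fix i r
    show "(cmod (contr d w i r - contr d w r i))\<^sup>2 \<le> 2 * (\<Sum>k<d. \<Sum>s<d. (cmod (w i k r s - w r k i s))\<^sup>2)"
      using trace_rank_two_squared_le[of "\<lambda>k. cnj (A i k)" "B r" "\<lambda>k. cnj (A r k)" "B i" d]
      by (simp add: contr_def w_def prod4_def sum_subtractf)
  qed
  also have "\<dots> = 2 * (\<Sum>i<d. \<Sum>r<d. \<Sum>k<d. \<Sum>s<d. (cmod (w i k r s - w r k i s))\<^sup>2)"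
    by (simp add: sum_distrib_left)
  also have "(\<Sum>i<d. \<Sum>r<d. \<Sum>k<d. \<Sum>s<d. (cmod (w i k r s - w r k i s))\<^sup>2)
      = (\<Sum>i<d. \<Sum>k<d. \<Sum>r<d. \<Sum>s<d. (cmod (w i k r s - w r k i s))\<^sup>2)"
    by (intro sum.cong refl sum.swap)
  finally show ?thesis by (simp add: form_1_F form_O_FO)
qed

text \<open>Grouping by \<open>(k, s)\<close> exhibits the squared Frobenius norm of the transpose
  of \<open>A\<close> times \<open>B\<close>, which has the same shape as
  \<open>form_O\<close>.\<close>

lemma form_F_prod4:
  "form_F d (prod4 A B) = (\<Sum>k<d. \<Sum>s<d. of_real ((cmod (\<Sum>i<d. A i k * B i s))\<^sup>2))"
proof -
  have "form_F d (prod4 A B)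
      = (\<Sum>k<d. \<Sum>s<d. \<Sum>i<d. \<Sum>r<d. A i k * cnj (B r s) * cnj (A r k) * B i s)"
    unfolding form_F_def prod4_def sum.cartesian_product
    by (rule sum.reindex_bij_witness[where i = "\<lambda>(k, s, i, r). (i, k, r, s)"
          and j = "\<lambda>(i, k, r, s). (k, s, i, r)"]) (auto simp: mult_ac)
  also have "\<dots> = (\<Sum>k<d. \<Sum>s<d. (\<Sum>i<d. A i k * B i s) * cnj (\<Sum>r<d. A r k * B r s))"
    by (simp add: sum_product mult_ac)
  finally show ?thesis by (simp only: complex_norm_square)
qed

text \<open>Transposing both matrices exchanges the tensor factors, and conjugating \<open>A\<close>
  undoes the resulting partial transposition. Each inequality thus has a mirror image with
  \<open>F\<close> and \<Omega> exchanged.\<close>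

lemma form_prod4_swap:
  fixes A B :: "nat \<Rightarrow> nat \<Rightarrow> complex"
  defines "A' \<equiv> \<lambda>k i. cnj (A i k)" and "B' \<equiv> \<lambda>s r. B r s"
  shows "form_1 d (prod4 A' B') = form_1 d (prod4 A B)"
    and "Re (form_F d (prod4 A' B')) = form_O d (prod4 A B)"
    and "form_O d (prod4 A' B') = Re (form_F d (prod4 A B))"
    and "Re (form_FO d (prod4 A' B')) = Re (form_FO d (prod4 A B))"
proof -
  show "form_1 d (prod4 A' B') = form_1 d (prod4 A B)"
    unfolding form_1_def prod4_def A'_def B'_def sum.cartesian_product
    by (rule sum.reindex_bij_witness[where i = "\<lambda>(k, i, s, r). (i, k, r, s)"
          and j = "\<lambda>(i, k, r, s). (k, i, s, r)"]) (auto simp: norm_mult)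
  show "Re (form_F d (prod4 A' B')) = form_O d (prod4 A B)"
    by (simp add: form_F_prod4 form_O_def contr_def prod4_def A'_def B'_def)
  show "form_O d (prod4 A' B') = Re (form_F d (prod4 A B))"
    by (simp add: form_F_prod4 form_O_def contr_def prod4_def A'_def B'_def)
  have "form_FO d (prod4 A' B') = (\<Sum>k<d. \<Sum>s<d. \<Sum>i<d. \<Sum>r<d. cnj (A i k) * cnj (B i s) * (A r s * B r k))"
    by (simp add: form_FO_def contr_def prod4_def A'_def B'_def sum_product)
  also have "\<dots> = (\<Sum>i<d. \<Sum>r<d. \<Sum>k<d. \<Sum>s<d. cnj (cnj (A r s) * B i s) * (cnj (A i k) * B r k))"
    unfolding sum.cartesian_product
    by (rule sum.reindex_bij_witness[where i = "\<lambda>(i, r, k, s). (k, s, i, r)"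
          and j = "\<lambda>(k, s, i, r). (i, r, k, s)"]) (auto simp: mult_ac)
  also have "\<dots> = (\<Sum>i<d. \<Sum>r<d. contr d (prod4 A B) i r * cnj (contr d (prod4 A B) r i))"
    unfolding contr_def prod4_def cnj_sum sum_product by (simp add: mult_ac)
  also have "\<dots> = cnj (form_FO d (prod4 A B))" by (simp add: form_FO_def)
  finally show "Re (form_FO d (prod4 A' B')) = Re (form_FO d (prod4 A B))" by simp
qed

section \<open>The algebra generated by the flip and the maximally entangled state\<close>

type_synonym idx4 = "nat \<times> nat \<times> nat \<times> nat"

abbreviation Q4 :: "nat \<Rightarrow> idx4 set" where
  "Q4 d \<equiv> {..<d} \<times> {..<d} \<times> {..<d} \<times> {..<d}"

text \<open>The four relations are the supports of the 0/1 matrices \<open>1\<close>,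
  \<open>F\<close>, \<Omega> and \<open>F \<otimes> \<Omega>\<close>, kept Boolean so that double
  sums collapse by parametrising the support.\<close>

fun ker_1 :: "idx4 \<Rightarrow> idx4 \<Rightarrow> bool" where
  "ker_1 (i, k, r, s) (j, l, t, u) \<longleftrightarrow> i = j \<and> r = t \<and> k = l \<and> s = u"

fun ker_F :: "idx4 \<Rightarrow> idx4 \<Rightarrow> bool" where
  "ker_F (i, k, r, s) (j, l, t, u) \<longleftrightarrow> i = t \<and> j = r \<and> k = l \<and> s = u"

fun ker_O :: "idx4 \<Rightarrow> idx4 \<Rightarrow> bool" where
  "ker_O (i, k, r, s) (j, l, t, u) \<longleftrightarrow> i = j \<and> r = t \<and> k = s \<and> l = u"

fun ker_FO :: "idx4 \<Rightarrow> idx4 \<Rightarrow> bool" where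
  "ker_FO (i, k, r, s) (j, l, t, u) \<longleftrightarrow> i = t \<and> j = r \<and> k = s \<and> l = u"

definition kern :: "real \<Rightarrow> real \<Rightarrow> real \<Rightarrow> real \<Rightarrow> idx4 \<Rightarrow> idx4 \<Rightarrow> complex" where
  "kern x y z w a b = of_real x * of_bool (ker_1 a b) + of_real y * of_bool (ker_F a b)
     + of_real z * of_bool (ker_O a b) + of_real w * of_bool (ker_FO a b)"

lemma sum_of_bool_reindex:
  fixes f :: "'a \<Rightarrow> 'a \<Rightarrow> complex"
  assumes "finite S" "bij_betw (\<lambda>x. (g x, h x)) X {(a, b) \<in> S \<times> S. R a b}"
  shows "(\<Sum>a\<in>S. \<Sum>b\<in>S. f a b * of_bool (R a b)) = (\<Sum>x\<in>X. f (g x) (h x))"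
proof -
  have "(\<Sum>a\<in>S. \<Sum>b\<in>S. f a b * of_bool (R a b)) = (\<Sum>(a, b)\<in>S \<times> S. f a b * of_bool (R a b))"
    by (rule sum.cartesian_product)
  also have "\<dots> = (\<Sum>p\<in>S \<times> S. if case_prod R p then case_prod f p else 0)"
    by (intro sum.cong) auto
  also have "\<dots> = (\<Sum>p\<in>{p \<in> S \<times> S. case_prod R p}. case_prod f p)"
    using assms(1) by (intro sum.inter_filter[symmetric]) simp
  also have "{p \<in> S \<times> S. case_prod R p} = {(a, b) \<in> S \<times> S. R a b}" by auto
  also have "(\<Sum>p\<in>\<dots>. case_prod f p) = (\<Sum>x\<in>X. case_prod f (g x, h x))"
    by (rule sum.reindex_bij_betw[OF assms(2), symmetric])
  finally show ?thesis by simp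
qed

lemma sum_ker:
  fixes f :: "idx4 \<Rightarrow> idx4 \<Rightarrow> complex"
  shows "(\<Sum>a\<in>Q4 d. \<Sum>b\<in>Q4 d. f a b * of_bool (ker_1 a b))
      = (\<Sum>i<d. \<Sum>k<d. \<Sum>r<d. \<Sum>s<d. f (i, k, r, s) (i, k, r, s))"
    and "(\<Sum>a\<in>Q4 d. \<Sum>b\<in>Q4 d. f a b * of_bool (ker_F a b))
      = (\<Sum>i<d. \<Sum>k<d. \<Sum>r<d. \<Sum>s<d. f (i, k, r, s) (r, k, i, s))"
    and "(\<Sum>a\<in>Q4 d. \<Sum>b\<in>Q4 d. f a b * of_bool (ker_O a b))
      = (\<Sum>i<d. \<Sum>r<d. \<Sum>k<d. \<Sum>l<d. f (i, k, r, k) (i, l, r, l))"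
    and "(\<Sum>a\<in>Q4 d. \<Sum>b\<in>Q4 d. f a b * of_bool (ker_FO a b))
      = (\<Sum>i<d. \<Sum>r<d. \<Sum>k<d. \<Sum>l<d. f (i, k, r, k) (r, l, i, l))"
proof -
  have fin: "finite (Q4 d)" by simp
  have 1: "bij_betw (\<lambda>x. (x, x)) (Q4 d) {(a, b) \<in> Q4 d \<times> Q4 d. ker_1 a b}"
    by (rule bij_betw_byWitness[where f' = fst]) auto
  have 2: "bij_betw (\<lambda>x. (case x of (i, k, r, s) \<Rightarrow> (i, k, r, s), case x of (i, k, r, s) \<Rightarrow> (r, k, i, s)))
      (Q4 d) {(a, b) \<in> Q4 d \<times> Q4 d. ker_F a b}"
    by (rule bij_betw_byWitness[where f' = fst]) auto
  have 3: "bij_betw (\<lambda>x. (case x of (i, r, k, l) \<Rightarrow> (i, k, r, k), case x of (i, r, k, l) \<Rightarrow> (i, l, r, l)))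
      (Q4 d) {(a, b) \<in> Q4 d \<times> Q4 d. ker_O a b}"
    by (rule bij_betw_byWitness[where f' = "\<lambda>((i, k, r, s), (j, l, t, u)). (i, r, k, l)"]) auto
  have 4: "bij_betw (\<lambda>x. (case x of (i, r, k, l) \<Rightarrow> (i, k, r, k), case x of (i, r, k, l) \<Rightarrow> (r, l, i, l)))
      (Q4 d) {(a, b) \<in> Q4 d \<times> Q4 d. ker_FO a b}"
    by (rule bij_betw_byWitness[where f' = "\<lambda>((i, k, r, s), (j, l, t, u)). (i, r, k, l)"]) auto
  note simps = sum.cartesian_product split_def
  show "(\<Sum>a\<in>Q4 d. \<Sum>b\<in>Q4 d. f a b * of_bool (ker_1 a b))
      = (\<Sum>i<d. \<Sum>k<d. \<Sum>r<d. \<Sum>s<d. f (i, k, r, s) (i, k, r, s))"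
    using sum_of_bool_reindex[OF fin 1, of f] by (simp add: simps)
  show "(\<Sum>a\<in>Q4 d. \<Sum>b\<in>Q4 d. f a b * of_bool (ker_F a b))
      = (\<Sum>i<d. \<Sum>k<d. \<Sum>r<d. \<Sum>s<d. f (i, k, r, s) (r, k, i, s))"
    using sum_of_bool_reindex[OF fin 2, of f] by (simp add: simps)
  show "(\<Sum>a\<in>Q4 d. \<Sum>b\<in>Q4 d. f a b * of_bool (ker_O a b))
      = (\<Sum>i<d. \<Sum>r<d. \<Sum>k<d. \<Sum>l<d. f (i, k, r, k) (i, l, r, l))"
    using sum_of_bool_reindex[OF fin 3, of f] by (simp add: simps)
  show "(\<Sum>a\<in>Q4 d. \<Sum>b\<in>Q4 d. f a b * of_bool (ker_FO a b))
      = (\<Sum>i<d. \<Sum>r<d. \<Sum>k<d. \<Sum>l<d. f (i, k, r, k) (r, l, i, l))"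
    using sum_of_bool_reindex[OF fin 4, of f] by (simp add: simps)
qed

lemma sum_kern:
  fixes f :: "idx4 \<Rightarrow> idx4 \<Rightarrow> complex"
  shows "(\<Sum>a\<in>Q4 d. \<Sum>b\<in>Q4 d. f a b * kern x y z w a b) =
      of_real x * (\<Sum>i<d. \<Sum>k<d. \<Sum>r<d. \<Sum>s<d. f (i, k, r, s) (i, k, r, s))
    + of_real y * (\<Sum>i<d. \<Sum>k<d. \<Sum>r<d. \<Sum>s<d. f (i, k, r, s) (r, k, i, s))
    + of_real z * (\<Sum>i<d. \<Sum>r<d. \<Sum>k<d. \<Sum>l<d. f (i, k, r, k) (i, l, r, l))
    + of_real w * (\<Sum>i<d. \<Sum>r<d. \<Sum>k<d. \<Sum>l<d. f (i, k, r, k) (r, l, i, l))"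
proof -
  have "f a b * kern x y z w a b = of_real x * (f a b * of_bool (ker_1 a b))
      + of_real y * (f a b * of_bool (ker_F a b)) + of_real z * (f a b * of_bool (ker_O a b))
      + of_real w * (f a b * of_bool (ker_FO a b))" for a b
    by (simp add: kern_def distrib_left mult_ac)
  then show ?thesis
    by (simp only: sum.distrib sum_distrib_left[symmetric] sum_ker)
qed

lemma qform_kern:
  fixes v :: "idx4 \<Rightarrow> complex"
  defines "V \<equiv> \<lambda>i k r s. v (i, k, r, s)"
  shows "qform (Q4 d) (kern x y z w) v =
    of_real (x * form_1 d V + y * Re (form_F d V) + z * form_O d V + w * Re (form_FO d V))"
proof -
  have re: "of_real y * form_F d V = of_real (y * Re (form_F d V))"
    "of_real w * form_FO d V = of_real (w * Re (form_FO d V))"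
    by (simp_all add: complex_eq_iff form_F_real form_FO_real)
  have sq: "of_real ((cmod c)\<^sup>2) = cnj c * c" for c
    by (simp only: complex_norm_square mult.commute)
  have "qform (Q4 d) (kern x y z w) v = (\<Sum>a\<in>Q4 d. \<Sum>b\<in>Q4 d. (cnj (v a) * v b) * kern x y z w a b)"
    unfolding qform_def by (simp only: mult_ac)
  also have "\<dots> = of_real x * of_real (form_1 d V) + of_real y * form_F d V
      + of_real z * of_real (form_O d V) + of_real w * form_FO d V"
    unfolding sum_kern form_1_def form_F_def form_O_def form_FO_def contr_def V_def
      of_real_sum sq cnj_sum sum_product ..
  finally show ?thesis by (simp only: re of_real_add of_real_mult)
qed

text \<open>
  The hypotheses are the signs of the eigenvalues of \<open>x + y F + z \<Omega> + w F \<otimes> \<Omega>\<close>, as \<open>F\<close> and \<open>\<Omega>\<close>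
  commute and have the eigenvalues \<open>\<plusminus>1\<close> and \<open>0, d\<close>.
\<close>

lemma psd_kern:
  assumes "0 < d" "0 \<le> x + y" "0 \<le> x - y"
    and "0 \<le> x + y + real d * (z + w)" "0 \<le> x - y + real d * (z - w)"
  shows "psd_kernel (Q4 d) (kern x y z w)"
  unfolding psd_kernel_def
proof
  fix v :: "idx4 \<Rightarrow> complex"
  define V where "V = (\<lambda>i k r s. v (i, k, r, s))"
  define a b c e where "a = form_1 d V" and "b = Re (form_F d V)" and "c = form_O d V"
    and "e = Re (form_FO d V)"
  note defs = a_def b_def c_def e_def
  \<comment> \<open>Up to positive factors these are the expectations of the joint spectral
    projections \<open>(1 \<plusminus> F) \<Omega>\<close> and
    \<open>(1 \<plusminus> F) (d - \<Omega>)\<close>. Weighted by their eigenvalues they add up to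
    \<open>2 * d\<close> times the form.\<close>
  have ineq: "0 \<le> c + e" "0 \<le> c - e" "0 \<le> d * (a + b) - (c + e)" "0 \<le> d * (a - b) - (c - e)"
    unfolding defs by (rule form_O_FO_nonneg form_contr_le)+
  note mult_nonneg_nonneg[OF assms(2) ineq(3)] mult_nonneg_nonneg[OF assms(3) ineq(4)]
    mult_nonneg_nonneg[OF assms(4) ineq(1)] mult_nonneg_nonneg[OF assms(5) ineq(2)]
  then have "0 \<le> (x + y) * (d * (a + b) - (c + e)) + (x - y) * (d * (a - b) - (c - e))
      + (x + y + real d * (z + w)) * (c + e) + (x - y + real d * (z - w)) * (c - e)"
    by (intro add_nonneg_nonneg)
  also have "\<dots> = 2 * d * (x * a + y * b + z * c + w * e)" by (simp add: algebra_simps)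
  finally have "0 \<le> x * a + y * b + z * c + w * e"
    using assms(1) by (simp add: zero_le_mult_iff)
  then show "0 \<le> qform (Q4 d) (kern x y z w) v"
    unfolding qform_kern V_def[symmetric] by (simp add: defs less_eq_complex_def)
qed

text \<open>Partial transposition of the output exchanges \<open>F\<close> and \<open>\<Omega>\<close> on each of the two tensor factors.\<close>

definition ptr :: "(idx4 \<Rightarrow> idx4 \<Rightarrow> complex) \<Rightarrow> idx4 \<Rightarrow> idx4 \<Rightarrow> complex" where
  "ptr M = (\<lambda>(i, k, r, s) (j, l, t, u). M (i, k, t, u) (j, l, r, s))"

text \<open>Exchanging the tensor factors by \<open>h\<close> brings the partial transpose back into
  the algebra with \<open>y\<close> and \<open>z\<close> interchanged, so \<open>psd_kern\<close>
  applies.\<close>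

lemma psd_ptr_kern:
  assumes "0 < d" "0 \<le> x + z" "0 \<le> x - z"
    and "0 \<le> x + z + real d * (y + w)" "0 \<le> x - z + real d * (y - w)"
  shows "psd_kernel (Q4 d) (ptr (kern x y z w))"
proof -
  define h :: "idx4 \<Rightarrow> idx4" where "h = (\<lambda>(i, k, r, s). (k, i, s, r))"
  have "inj_on h (Q4 d)" by (auto simp: inj_on_def h_def)
  moreover have "psd_kernel (h ` Q4 d) (kern x z y w)"
    by (rule psd_kernel_subset[OF psd_kern[OF assms]]) (auto simp: h_def)
  ultimately have "psd_kernel (Q4 d) (\<lambda>a b. kern x z y w (h a) (h b))"
    by (rule psd_kernel_reindex)
  also have "(\<lambda>a b. kern x z y w (h a) (h b)) = ptr (kern x y z w)"
  proof (intro ext)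
    fix a b :: idx4
    obtain i k r s where a: "a = (i, k, r, s)" by (cases a)
    obtain j l t u where b: "b = (j, l, t, u)" by (cases b)
    have "ker_1 (k, i, s, r) (l, j, u, t) = ker_1 (i, k, t, u) (j, l, r, s)"
      "ker_F (k, i, s, r) (l, j, u, t) = ker_O (i, k, t, u) (j, l, r, s)"
      "ker_O (k, i, s, r) (l, j, u, t) = ker_F (i, k, t, u) (j, l, r, s)"
      "ker_FO (k, i, s, r) (l, j, u, t) = ker_FO (i, k, t, u) (j, l, r, s)"
      by auto
    then show "kern x z y w (h a) (h b) = ptr (kern x y z w) a b"
      by (simp add: a b h_def ptr_def kern_def del: ker_1.simps ker_F.simps ker_O.simps ker_FO.simps)
  qed
  finally show ?thesis .
qed

section \<open>Trace pairing of kernels\<close>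

definition pairing :: "'a set \<Rightarrow> ('a \<Rightarrow> 'a \<Rightarrow> complex) \<Rightarrow> ('a \<Rightarrow> 'a \<Rightarrow> complex) \<Rightarrow> complex" where
  "pairing S M N = (\<Sum>a\<in>S. \<Sum>b\<in>S. M b a * N a b)"

text \<open>A Gram decomposition of \<open>M\<close> turns the trace of the product into a sum of
  values of the form of \<open>N\<close>.\<close>

lemma pairing_nonneg:
  assumes "finite S" "psd_kernel S M" "psd_kernel S N"
  shows "0 \<le> pairing S M N"
proof -
  obtain K where K: "\<And>a b. a \<in> S \<Longrightarrow> b \<in> S \<Longrightarrow> M a b = (\<Sum>m\<in>S. K m a * cnj (K m b))"
    using psd_kernel_gram[OF assms(1,2)] by blast
  have "pairing S M N = (\<Sum>a\<in>S. \<Sum>b\<in>S. \<Sum>m\<in>S. cnj (K m a) * N a b * K m b)"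
    unfolding pairing_def by (intro sum.cong refl) (simp add: K sum_distrib_left sum_distrib_right mult_ac)
  also have "\<dots> = (\<Sum>a\<in>S. \<Sum>m\<in>S. \<Sum>b\<in>S. cnj (K m a) * N a b * K m b)"
    by (intro sum.cong refl sum.swap)
  also have "\<dots> = (\<Sum>m\<in>S. qform S N (K m))"
    unfolding qform_def by (rule sum.swap)
  finally show ?thesis using assms(3) by (simp add: psd_kernel_def sum_nonneg)
qed

text \<open>Lets the partial transposition pass from an unknown kernel to the witness.\<close>

lemma pairing_ptr: "pairing (Q4 d) (ptr M) N = pairing (Q4 d) M (ptr N)"
  unfolding pairing_def sum.cartesian_product
  by (rule sum.reindex_bij_witness[where
        i = "\<lambda>((i, k, r, s), (j, l, t, u)). ((i, k, t, u), (j, l, r, s))" and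
        j = "\<lambda>((i, k, r, s), (j, l, t, u)). ((i, k, t, u), (j, l, r, s))"])
    (auto simp: ptr_def)

text \<open>The powers are traces of products of generators: \<open>F\<^sup>2 = 1\<close>,
  \<open>\<Omega>\<^sup>2 = d \<Omega>\<close>, and \<open>1\<close>, \<open>F\<close>, \<Omega>,
  \<open>F \<otimes> \<Omega>\<close> have traces \<open>d^4\<close>, \<open>d^3\<close>,
  \<open>d^3\<close>, \<open>d^2\<close>. The proof counts index coincidences.\<close>

lemma pairing_kern:
  "pairing (Q4 d) (kern x y z w) (kern x' y' z' w') =
    of_real (x' * (x * real d ^ 4 + y * real d ^ 3 + z * real d ^ 3 + w * real d ^ 2)
      + y' * (x * real d ^ 3 + y * real d ^ 4 + z * real d ^ 2 + w * real d ^ 3)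
      + z' * (x * real d ^ 3 + y * real d ^ 2 + z * real d ^ 4 + w * real d ^ 3)
      + w' * (x * real d ^ 2 + y * real d ^ 3 + z * real d ^ 3 + w * real d ^ 4))"
proof -
  have count: "(\<Sum>i<d. \<Sum>k<d. \<Sum>r<d. \<Sum>s<d. X + Y * of_bool (i = r) + Z * of_bool (k = s)
      + W * (of_bool (i = r) * of_bool (k = s)))
    = X * of_nat d ^ 4 + Y * of_nat d ^ 3 + Z * of_nat d ^ 3 + W * of_nat d ^ 2" for X Y Z W :: complex
  proof -
    have 1: "(\<Sum>i<d. \<Sum>k<d. \<Sum>r<d. \<Sum>s<d. X) = X * of_nat d ^ 4"
      by (simp add: power4_eq_xxxx)
    have b: "(\<Sum>s<d. of_bool (k = s)) = (1 :: complex)" if "k \<in> {..<d}" for k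
      using that by (simp add: of_bool_def)
    have 2: "(\<Sum>i<d. \<Sum>k<d. \<Sum>r<d. \<Sum>s<d. Y * of_bool (i = r)) = Y * of_nat d ^ 3"
    proof -
      have "(\<Sum>i<d. \<Sum>k<d. \<Sum>r<d. \<Sum>s<d. Y * of_bool (i = r))
          = (\<Sum>i<d. \<Sum>k<d. of_nat d * Y * (\<Sum>r<d. of_bool (i = r)))"
        by (simp only: sum_constant card_lessThan sum_distrib_left mult.assoc)
      also have "\<dots> = (\<Sum>i<d. \<Sum>k<d. of_nat d * Y * 1)"
        by (intro sum.cong refl) (simp only: b)
      finally show ?thesis by (simp add: power3_eq_cube)
    qed
    have 3: "(\<Sum>i<d. \<Sum>k<d. \<Sum>r<d. \<Sum>s<d. Z * of_bool (k = s)) = Z * of_nat d ^ 3"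
    proof -
      have "(\<Sum>i<d. \<Sum>k<d. \<Sum>r<d. \<Sum>s<d. Z * of_bool (k = s)) = (\<Sum>i<d. \<Sum>k<d. \<Sum>r<d. Z * 1)"
        by (intro sum.cong refl) (simp only: sum_distrib_left[symmetric] b)
      then show ?thesis by (simp add: power3_eq_cube)
    qed
    have 4: "(\<Sum>i<d. \<Sum>k<d. \<Sum>r<d. \<Sum>s<d. W * (of_bool (i = r) * of_bool (k = s))) = W * of_nat d ^ 2"
    proof -
      have "(\<Sum>i<d. \<Sum>k<d. \<Sum>r<d. \<Sum>s<d. W * (of_bool (i = r) * of_bool (k = s))) = (\<Sum>i<d. \<Sum>k<d. W * 1)"
        by (intro sum.cong refl) (simp only: sum_distrib_left[symmetric] b mult_1_right)
      then show ?thesis by (simp add: power2_eq_square)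
    qed
    show ?thesis by (simp only: sum.distrib 1 2 3 4)
  qed
  have c1: "(\<Sum>i<d. \<Sum>k<d. \<Sum>r<d. \<Sum>s<d. kern x y z w (i, k, r, s) (i, k, r, s))
      = of_real x * of_nat d ^ 4 + of_real y * of_nat d ^ 3 + of_real z * of_nat d ^ 3 + of_real w * of_nat d ^ 2"
    unfolding count[symmetric] by (intro sum.cong refl) (auto simp: kern_def)
  have c2: "(\<Sum>i<d. \<Sum>k<d. \<Sum>r<d. \<Sum>s<d. kern x y z w (r, k, i, s) (i, k, r, s))
      = of_real y * of_nat d ^ 4 + of_real x * of_nat d ^ 3 + of_real w * of_nat d ^ 3 + of_real z * of_nat d ^ 2"
    unfolding count[symmetric] by (intro sum.cong refl) (auto simp: kern_def)
  have c3: "(\<Sum>i<d. \<Sum>r<d. \<Sum>k<d. \<Sum>l<d. kern x y z w (i, l, r, l) (i, k, r, k))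
      = of_real z * of_nat d ^ 4 + of_real w * of_nat d ^ 3 + of_real x * of_nat d ^ 3 + of_real y * of_nat d ^ 2"
  proof -
    have "(\<Sum>i<d. \<Sum>r<d. \<Sum>k<d. \<Sum>l<d. kern x y z w (i, l, r, l) (i, k, r, k))
      = (\<Sum>i<d. \<Sum>k<d. \<Sum>r<d. \<Sum>l<d. kern x y z w (i, l, r, l) (i, k, r, k))"
      by (intro sum.cong refl sum.swap)
    then show ?thesis
      unfolding count[symmetric] by (simp only:) (intro sum.cong refl, auto simp: kern_def)
  qed
  have c4: "(\<Sum>i<d. \<Sum>r<d. \<Sum>k<d. \<Sum>l<d. kern x y z w (r, l, i, l) (i, k, r, k))
      = of_real w * of_nat d ^ 4 + of_real z * of_nat d ^ 3 + of_real y * of_nat d ^ 3 + of_real x * of_nat d ^ 2"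
  proof -
    have "(\<Sum>i<d. \<Sum>r<d. \<Sum>k<d. \<Sum>l<d. kern x y z w (r, l, i, l) (i, k, r, k))
      = (\<Sum>i<d. \<Sum>k<d. \<Sum>r<d. \<Sum>l<d. kern x y z w (r, l, i, l) (i, k, r, k))"
      by (intro sum.cong refl sum.swap)
    then show ?thesis
      unfolding count[symmetric] by (simp only:) (intro sum.cong refl, auto simp: kern_def)
  qed
  show ?thesis
    unfolding pairing_def sum_kern c1 c2 c3 c4 by (simp add: algebra_simps)
qed

section \<open>Choi kernels of linear maps\<close>

lemma sum_mult_index:
  "(\<Sum>x<a * b. f x) = (\<Sum>i<a. \<Sum>k<b. f (i * b + k))" for a b :: nat
proof -
  have "(\<Sum>i<a. \<Sum>k<b. f (i * b + k)) = (\<Sum>(i, k)\<in>{..<a} \<times> {..<b}. f (i * b + k))"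
    by (rule sum.cartesian_product)
  also have "\<dots> = (\<Sum>x<a * b. f x)"
  proof (rule sum.reindex_bij_witness[where i = "\<lambda>x. (x div b, x mod b)" and j = "\<lambda>(i, k). i * b + k"])
    fix x assume x: "x \<in> {..<a * b}"
    then have "0 < b" by (auto intro: Nat.gr0I)
    with x show "(x div b, x mod b) \<in> {..<a} \<times> {..<b}" by (auto simp: less_mult_imp_div_less)
  qed (auto simp: pair_index_less)
  finally show ?thesis by simp
qed

lemma quadratic_form_eq_qform:
  assumes "A \<in> carrier_mat n n" "v \<in> carrier_vec n"
  shows "(A *\<^sub>v v) \<bullet>c v = qform {..<n} (\<lambda>i j. A $$ (i, j)) (\<lambda>i. v $ i)"
proof -
  have "(A *\<^sub>v v) \<bullet>c v = (\<Sum>i<n. (\<Sum>j<n. A $$ (i, j) * v $ j) * cnj (v $ i))"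
    using assms by (simp add: scalar_prod_def lessThan_atLeast0)
  also have "\<dots> = qform {..<n} (\<lambda>i j. A $$ (i, j)) (\<lambda>i. v $ i)"
    unfolding qform_def sum_distrib_right by (simp add: mult_ac)
  finally show ?thesis .
qed

lemma psd_iff_psd_kernel:
  "psd n A \<longleftrightarrow> A \<in> carrier_mat n n \<and> psd_kernel {..<n} (\<lambda>i j. A $$ (i, j))"
proof (cases "A \<in> carrier_mat n n")
  case True
  have "qform {..<n} M (\<lambda>i. vec n v $ i) = qform {..<n} M v" for M v
    by (simp add: qform_def)
  then show ?thesis
    using quadratic_form_eq_qform[OF True] True unfolding psd_def psd_kernel_def
    by (metis vec_carrier)
qed (simp add: psd_def)

text \<open>Inverse Choi correspondence, with the indices of \<open>C\<close> kept as pairs of an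
  input and an output index.\<close>

definition kmap :: "nat \<Rightarrow> (nat \<times> nat \<Rightarrow> nat \<times> nat \<Rightarrow> complex) \<Rightarrow> complex mat \<Rightarrow> complex mat" where
  "kmap n C X = mat n n (\<lambda>(r, c). \<Sum>i<n. \<Sum>j<n. X $$ (i, j) * C (i, r) (j, c))"

definition map_kernel :: "nat \<Rightarrow> (complex mat \<Rightarrow> complex mat) \<Rightarrow> nat \<times> nat \<Rightarrow> nat \<times> nat \<Rightarrow> complex" where
  "map_kernel n T = (\<lambda>(i, r) (j, c). T (mat_unit n i j) $$ (r, c))"

lemma linear_map_kmap: "linear_map n n (kmap n C)"
  unfolding linear_map_def kmap_def
  by (auto intro!: eq_matI simp: sum.distrib distrib_right sum_distrib_left mult.assoc)

lemma kmap_mat_unit: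
  assumes "i < n" "j < n" "r < n" "c < n"
  shows "kmap n C (mat_unit n i j) $$ (r, c) = C (i, r) (j, c)"
proof -
  have "kmap n C (mat_unit n i j) $$ (r, c)
      = (\<Sum>i'<n. \<Sum>j'<n. C (i', r) (j', c) * (if i = i' \<and> j = j' then 1 else 0))"
    using assms unfolding kmap_def by (auto intro!: sum.cong)
  with sum_delta2[OF assms(1,2), of "\<lambda>i j. C (i, r) (j, c)"] show ?thesis by simp
qed

lemma linear_map_eq_kmap:
  assumes "linear_map n n T" "X \<in> carrier_mat n n"
  shows "T X = kmap n (map_kernel n T) X"
proof -
  have "T X \<in> carrier_mat n n" using assms by (simp add: linear_map_def)
  then show ?thesis
    by (intro eq_matI) (auto simp: kmap_def map_kernel_def linear_map_entry_expand[OF assms])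
qed

lemma index_tensor_id:
  assumes T: "linear_map n m T" and "x < k" "y < k" "r < m" "c < m"
  shows "tensor_map k k n m id T X $$ (x * m + r, y * m + c)
    = (\<Sum>i<n. \<Sum>j<n. X $$ (x * n + i, y * n + j) * T (mat_unit n i j) $$ (r, c))"
proof -
  have Tc: "T (mat_unit n i j) \<in> carrier_mat m m" for i j
    using T by (simp add: linear_map_def)
  have "tensor_map k k n m id T X $$ (x * m + r, y * m + c) =
     (\<Sum>i'<k. \<Sum>j'<k. (\<Sum>i<n. \<Sum>j<n. X $$ (i' * n + i, j' * n + j) * T (mat_unit n i j) $$ (r, c))
        * (if x = i' \<and> y = j' then 1 else 0))"
    using assms by (auto intro!: sum.cong
        simp: tensor_map_def index_kron[OF mat_unit_carrier Tc] pair_index_less)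
  then show ?thesis
    using sum_delta2[OF assms(2,3), of "\<lambda>i' j'. \<Sum>i<n. \<Sum>j<n. X $$ (i' * n + i, j' * n + j) * T (mat_unit n i j) $$ (r, c)"]
    by simp
qed

lemma linear_map_tensor_map: "linear_map (a * b) (a' * b') (tensor_map a a' b b' K L)"
  unfolding linear_map_def tensor_map_def
  by (auto intro!: eq_matI simp: sum.distrib distrib_right sum_distrib_left mult.assoc pair_index_less)

section \<open>Choi's theorem and positivity on product vectors\<close>

lemma psd_omega_mat: "psd (d * d) (omega_mat d)"
  unfolding psd_iff_psd_kernel psd_kernel_def
proof (intro conjI allI)
  show "omega_mat d \<in> carrier_mat (d * d) (d * d)" by (simp add: omega_mat_def)
  fix v :: "nat \<Rightarrow> complex"
  define s where "s = (\<Sum>i<d. v (i * d + i))"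
  have "qform {..<d * d} (\<lambda>i j. omega_mat d $$ (i, j)) v = (\<Sum>i<d. \<Sum>k<d. \<Sum>j<d. \<Sum>l<d.
      cnj (v (i * d + k)) * (if i = k \<and> j = l then 1 else 0) * v (j * d + l))"
    unfolding qform_def sum_mult_index by (intro sum.cong refl) (simp add: index_omega_mat)
  also have "\<dots> = (\<Sum>i<d. \<Sum>k<d. \<Sum>j<d. if k = i then cnj (v (i * d + k)) * v (j * d + j) else 0)"
  proof (intro sum.cong refl)
    fix i k j assume "j \<in> {..<d}"
    have "(\<Sum>l<d. cnj (v (i * d + k)) * (if i = k \<and> j = l then 1 else 0) * v (j * d + l))
        = (\<Sum>l<d. if l = j then if k = i then cnj (v (i * d + k)) * v (j * d + l) else 0 else 0)"
      by (intro sum.cong) auto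
    then show "(\<Sum>l<d. cnj (v (i * d + k)) * (if i = k \<and> j = l then 1 else 0) * v (j * d + l))
        = (if k = i then cnj (v (i * d + k)) * v (j * d + j) else 0)"
      using \<open>j \<in> {..<d}\<close> by simp
  qed
  also have "\<dots> = (\<Sum>i<d. \<Sum>k<d. if k = i then cnj (v (i * d + k)) * s else 0)"
    by (intro sum.cong refl) (simp add: s_def sum_distrib_left)
  also have "\<dots> = (\<Sum>i<d. cnj (v (i * d + i)) * s)" by simp
  also have "\<dots> = cnj s * s" by (simp add: s_def sum_distrib_right)
  finally show "0 \<le> qform {..<d * d} (\<lambda>i j. omega_mat d $$ (i, j)) v"
    by (simp add: less_eq_complex_def)
qed

text \<open>One half of Choi's theorem: with an ancilla of size \<open>n\<close> the image of
  \<open>omega_mat n\<close> is the Choi matrix.\<close>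

lemma psd_map_kernel:
  assumes "completely_positive n n T"
  shows "psd_kernel ({..<n} \<times> {..<n}) (map_kernel n T)"
proof -
  have lin: "linear_map n n T" and "positive_map (n * n) (n * n) (tensor_map n n n n id T)"
    using assms by (auto simp: completely_positive_def)
  then have "psd (n * n) (choi n T)"
    using psd_omega_mat by (simp add: positive_map_def choi_def)
  then have psd: "psd_kernel {..<n * n} (\<lambda>x y. choi n T $$ (x, y))"
    by (simp add: psd_iff_psd_kernel)
  define h where "h = (\<lambda>(i, r). i * n + r :: nat)"
  have inj: "inj_on h ({..<n} \<times> {..<n})"
    by (rule inj_on_inverseI[where g = "\<lambda>x. (x div n, x mod n)"]) (auto simp: h_def)
  have img: "h ` ({..<n} \<times> {..<n}) \<subseteq> {..<n * n}"
    by (auto simp: h_def pair_index_less)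
  have "psd_kernel ({..<n} \<times> {..<n}) (\<lambda>a b. choi n T $$ (h a, h b))"
    by (rule psd_kernel_reindex[OF inj, of "\<lambda>x y. choi n T $$ (x, y)"])
      (rule psd_kernel_subset[OF psd _ img], simp)
  moreover have "choi n T $$ (h a, h b) = map_kernel n T a b"
    if "a \<in> {..<n} \<times> {..<n}" "b \<in> {..<n} \<times> {..<n}" for a b
    using that by (auto simp: h_def map_kernel_def index_choi[OF lin])
  ultimately show ?thesis
    unfolding psd_kernel_def qform_def by (auto cong: sum.cong)
qed

text \<open>The Gram vectors of \<open>C\<close> act as Kraus operators, each pulling
  \<open>v\<close> back to a test vector for \<open>X\<close>.\<close>

lemma qform_tensor_gram:
  fixes K :: "'m \<Rightarrow> nat \<times> nat \<Rightarrow> complex" and n k :: nat and X :: "complex mat"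
  assumes K: "\<And>a b. a \<in> {..<n} \<times> {..<n} \<Longrightarrow> b \<in> {..<n} \<times> {..<n} \<Longrightarrow>
    C a b = (\<Sum>m\<in>S. K m a * cnj (K m b))"
  shows "qform {..<k * n} (\<lambda>x y. tensor_map k k n n id (kmap n C) X $$ (x, y)) v =
    (\<Sum>m\<in>S. qform {..<k * n} (\<lambda>x y. X $$ (x, y))
      (\<lambda>x. \<Sum>c<n. cnj (K m (x mod n, c)) * v (x div n * n + c)))"
proof -
  define g where "g m x i = (\<Sum>r<n. cnj (K m (i, r)) * v (x * n + r))" for m x i
  have "qform {..<k * n} (\<lambda>x y. tensor_map k k n n id (kmap n C) X $$ (x, y)) v =
    (\<Sum>x<k. \<Sum>r<n. \<Sum>y<k. \<Sum>c<n. \<Sum>i<n. \<Sum>j<n. \<Sum>m\<in>S.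
      X $$ (x * n + i, y * n + j) * (K m (i, r) * cnj (v (x * n + r)) * (cnj (K m (j, c)) * v (y * n + c))))"
    unfolding qform_def sum_mult_index
    by (intro sum.cong refl)
      (simp add: index_tensor_id[OF linear_map_kmap] kmap_mat_unit K sum_distrib_left sum_distrib_right mult_ac)
  also have "\<dots> = (\<Sum>m\<in>S. \<Sum>x<k. \<Sum>i<n. \<Sum>y<k. \<Sum>j<n. \<Sum>r<n. \<Sum>c<n.
      X $$ (x * n + i, y * n + j) * (K m (i, r) * cnj (v (x * n + r)) * (cnj (K m (j, c)) * v (y * n + c))))"
    unfolding sum.cartesian_product
    by (rule sum.reindex_bij_witness[where i = "\<lambda>(m, x, i, y, j, r, c). (x, r, y, c, i, j, m)"
          and j = "\<lambda>(x, r, y, c, i, j, m). (m, x, i, y, j, r, c)"]) auto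
  also have "\<dots> = (\<Sum>m\<in>S. \<Sum>x<k. \<Sum>i<n. \<Sum>y<k. \<Sum>j<n.
      cnj (g m x i) * X $$ (x * n + i, y * n + j) * g m y j)"
  proof (intro sum.cong refl)
    fix m x i y j
    have "(\<Sum>r<n. \<Sum>c<n. X $$ (x * n + i, y * n + j) *
        (K m (i, r) * cnj (v (x * n + r)) * (cnj (K m (j, c)) * v (y * n + c))))
      = X $$ (x * n + i, y * n + j) * ((\<Sum>r<n. K m (i, r) * cnj (v (x * n + r))) * g m y j)"
      unfolding g_def sum_product by (simp only: sum_distrib_left)
    also have "(\<Sum>r<n. K m (i, r) * cnj (v (x * n + r))) = cnj (g m x i)"
      by (simp add: g_def)
    finally show "(\<Sum>r<n. \<Sum>c<n. X $$ (x * n + i, y * n + j) *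
        (K m (i, r) * cnj (v (x * n + r)) * (cnj (K m (j, c)) * v (y * n + c))))
      = cnj (g m x i) * X $$ (x * n + i, y * n + j) * g m y j"
      by (simp only: mult_ac)
  qed
  also have "\<dots> = (\<Sum>m\<in>S. qform {..<k * n} (\<lambda>x y. X $$ (x, y)) (\<lambda>x. g m (x div n) (x mod n)))"
    unfolding qform_def sum_mult_index by (intro sum.cong refl) simp
  finally show ?thesis by (simp add: g_def)
qed

text \<open>The other half of Choi's theorem, with the Kraus form supplied by
  \<open>psd_kernel_gram\<close>.\<close>

lemma completely_positive_kmap:
  assumes "psd_kernel ({..<n} \<times> {..<n}) C"
  shows "completely_positive n n (kmap n C)"
proof -
  obtain K where K: "\<And>a b. a \<in> {..<n} \<times> {..<n} \<Longrightarrow> b \<in> {..<n} \<times> {..<n} \<Longrightarrow>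
      C a b = (\<Sum>m\<in>{..<n} \<times> {..<n}. K m a * cnj (K m b))"
    using psd_kernel_gram[OF _ assms] by auto
  have "psd (k * n) (tensor_map k k n n id (kmap n C) X)" if "psd (k * n) X" for k X
  proof -
    have X: "psd_kernel {..<k * n} (\<lambda>x y. X $$ (x, y))"
      using that by (simp add: psd_iff_psd_kernel)
    have "0 \<le> qform {..<k * n} (\<lambda>x y. tensor_map k k n n id (kmap n C) X $$ (x, y)) v" for v
    proof -
      have eq: "qform {..<k * n} (\<lambda>x y. tensor_map k k n n id (kmap n C) X $$ (x, y)) v =
        (\<Sum>m\<in>{..<n} \<times> {..<n}. qform {..<k * n} (\<lambda>x y. X $$ (x, y))
          (\<lambda>x. \<Sum>c<n. cnj (K m (x mod n, c)) * v (x div n * n + c)))"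
        by (rule qform_tensor_gram) (rule K)
      show ?thesis
        unfolding eq using X by (intro sum_nonneg) (simp add: psd_kernel_def)
    qed
    then have "psd_kernel {..<k * n} (\<lambda>x y. tensor_map k k n n id (kmap n C) X $$ (x, y))"
      by (simp add: psd_kernel_def)
    then show ?thesis by (simp add: psd_iff_psd_kernel tensor_map_def)
  qed
  then show ?thesis
    by (simp add: completely_positive_def positive_map_def linear_map_kmap linear_map_tensor_map)
qed

lemma positive_map_kmap:
  "positive_map n n (kmap n C) \<longleftrightarrow>
    (\<forall>a v. 0 \<le> qform ({..<n} \<times> {..<n}) C (\<lambda>(i, r). cnj (a i) * v r))"
proof
  \<comment> \<open>Serves both directions: one Gram vector for rank one inputs, \<open>n\<close> of
    them for a general psd input.\<close>
  have form: "qform {..<n} (\<lambda>r c. kmap n C X $$ (r, c)) v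
      = (\<Sum>m\<in>S. qform ({..<n} \<times> {..<n}) C (\<lambda>(i, r). cnj (K m i) * v r))"
    if K: "\<And>i j. i < n \<Longrightarrow> j < n \<Longrightarrow> X $$ (i, j) = (\<Sum>m\<in>S. K m i * cnj (K m j))"
    for X v and S :: "nat set" and K
  proof -
    have "qform {..<n} (\<lambda>r c. kmap n C X $$ (r, c)) v = (\<Sum>r<n. \<Sum>c<n. \<Sum>i<n. \<Sum>j<n. \<Sum>m\<in>S.
        K m i * cnj (v r) * C (i, r) (j, c) * (cnj (K m j) * v c))"
      unfolding qform_def
      by (intro sum.cong refl) (simp add: kmap_def K sum_distrib_left sum_distrib_right mult_ac)
    also have "\<dots> = (\<Sum>m\<in>S. \<Sum>i<n. \<Sum>r<n. \<Sum>j<n. \<Sum>c<n.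
        K m i * cnj (v r) * C (i, r) (j, c) * (cnj (K m j) * v c))"
      unfolding sum.cartesian_product
      by (rule sum.reindex_bij_witness[where i = "\<lambda>(m, i, r, j, c). (r, c, i, j, m)"
            and j = "\<lambda>(r, c, i, j, m). (m, i, r, j, c)"]) auto
    also have "\<dots> = (\<Sum>m\<in>S. qform ({..<n} \<times> {..<n}) C (\<lambda>(i, r). cnj (K m i) * v r))"
      by (simp add: qform_def sum.cartesian_product')
    finally show ?thesis .
  qed
  {
    assume pos: "positive_map n n (kmap n C)"
    show "\<forall>a v. 0 \<le> qform ({..<n} \<times> {..<n}) C (\<lambda>(i, r). cnj (a i) * v r)"
    proof (intro allI)
      fix a v :: "nat \<Rightarrow> complex"
      define X where "X = mat n n (\<lambda>(i, j). a i * cnj (a j))"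
      have X: "X $$ (i, j) = (\<Sum>m\<in>{0::nat}. a i * cnj (a j))" if "i < n" "j < n" for i j
        using that by (simp add: X_def)
      have "0 \<le> qform {..<n} (\<lambda>i j. X $$ (i, j)) w" for w
      proof -
        have "qform {..<n} (\<lambda>i j. X $$ (i, j)) w = (\<Sum>i<n. cnj (w i) * a i) * cnj (\<Sum>j<n. cnj (w j) * a j)"
          by (simp add: qform_def X sum_product mult_ac)
        moreover have "0 \<le> z * cnj z" for z by (simp add: less_eq_complex_def)
        ultimately show ?thesis by (simp only:)
      qed
      then have "psd n X" by (simp add: psd_iff_psd_kernel psd_kernel_def X_def)
      then have "psd n (kmap n C X)" using pos by (simp add: positive_map_def)
      then have "0 \<le> qform {..<n} (\<lambda>r c. kmap n C X $$ (r, c)) v"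
        by (simp add: psd_iff_psd_kernel psd_kernel_def)
      then show "0 \<le> qform ({..<n} \<times> {..<n}) C (\<lambda>(i, r). cnj (a i) * v r)"
        using form[where S = "{0::nat}" and K = "\<lambda>_. a" and X = X and v = v, OF X] by simp
    qed
  next
    assume *: "\<forall>a v. 0 \<le> qform ({..<n} \<times> {..<n}) C (\<lambda>(i, r). cnj (a i) * v r)"
    show "positive_map n n (kmap n C)"
      unfolding positive_map_def
    proof (intro conjI allI impI linear_map_kmap)
      fix X assume "psd n X"
      then obtain K where "\<And>i j. i < n \<Longrightarrow> j < n \<Longrightarrow> X $$ (i, j) = (\<Sum>m<n. K m i * cnj (K m j))"
        using psd_kernel_gram[of "{..<n}" "\<lambda>i j. X $$ (i, j)"] by (auto simp: psd_iff_psd_kernel)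
      from form[OF this] * have "psd_kernel {..<n} (\<lambda>r c. kmap n C X $$ (r, c))"
        by (simp add: psd_kernel_def sum_nonneg)
      then show "psd n (kmap n C X)" by (simp add: psd_iff_psd_kernel kmap_def)
    qed
  }
qed

section \<open>Positivity and decomposability in terms of the flip and the maximally entangled state\<close>

text \<open>Here \<open>u\<close>, \<open>x\<close>, \<open>y\<close>, \<open>t\<close> stand for
  the expectations of \<open>1\<close>, \<open>F\<close>, \<Omega>,
  \<open>F \<otimes> \<Omega>\<close> in a product vector; \<open>ineq1\<close> and
  \<open>ineq2\<close> are the corners \<open>(1, 1/2)\<close> and \<open>(1/2, 1)\<close>. Affinity
  in each parameter settles the cases off the curved part.\<close>

lemma bilinear_form_nonneg:
  fixes t u x y q1 q2 :: real
  assumes t: "\<bar>t\<bar> \<le> x" "\<bar>t\<bar> \<le> y" and xy: "x \<le> u" "y \<le> u"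
    and ineq1: "0 \<le> 2 * u - 2 * x - y + t" and ineq2: "0 \<le> 2 * u - x - 2 * y + t"
    and q: "- 1 \<le> q1" "q1 \<le> 1" "- 1 \<le> q2" "q2 \<le> 1" "(1 + q1) * (1 + q2) \<le> 3"
  shows "0 \<le> u - q1 * x - q2 * y + q1 * q2 * t"
proof -
  \<comment> \<open>The form is affine in \<open>a\<close>: interpolate between
    \<open>a = - 1\<close> and \<open>a = 1\<close>.\<close>
  have nonpos: "0 \<le> u - a * x - b * y + a * b * t"
    if "- 1 \<le> a" "a \<le> 1" "b \<le> 0" "\<bar>t\<bar> \<le> x" "\<bar>t\<bar> \<le> y" "x \<le> u" "y \<le> u" for a b x y :: real
  proof -
    have "0 \<le> (- b) * (y - t)" "0 \<le> (- b) * (y + t)"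
      using that by (intro mult_nonneg_nonneg; linarith)+
    then have "0 \<le> (1 + a) * ((u - x) + (- b) * (y - t))" "0 \<le> (1 - a) * ((u + x) + (- b) * (y + t))"
      using that by (intro mult_nonneg_nonneg[of "1 + a"] mult_nonneg_nonneg[of "1 - a"]; linarith)+
    then have "0 \<le> (1 + a) * ((u - x) + (- b) * (y - t)) + (1 - a) * ((u + x) + (- b) * (y + t))"
      by (rule add_nonneg_nonneg)
    also have "\<dots> = 2 * (u - a * x - b * y + a * b * t)" by (simp add: algebra_simps)
    finally show ?thesis by simp
  qed
  \<comment> \<open>Interpolate between \<open>a = 0\<close> and \<open>a = 1 / 2\<close>; at each
    end lowering \<open>b\<close> from 1 only increases the form.\<close>
  have small: "0 \<le> u - a * x - b * y + a * b * t"
    if "0 \<le> a" "a \<le> 1 / 2" "0 \<le> b" "b \<le> 1" "\<bar>t\<bar> \<le> x" "\<bar>t\<bar> \<le> y" "x \<le> u" "y \<le> u"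
      "0 \<le> 2 * u - x - 2 * y + t" for a b x y :: real
  proof -
    have "0 \<le> (1 - b) * y" "0 \<le> (1 - b) * (2 * y - t)"
      using that by (intro mult_nonneg_nonneg; linarith)+
    then have "0 \<le> (1 - 2 * a) * ((u - y) + (1 - b) * y)"
      "0 \<le> a * ((2 * u - x - 2 * y + t) + (1 - b) * (2 * y - t))"
      using that by (intro mult_nonneg_nonneg[of "1 - 2 * a"] mult_nonneg_nonneg[of a]; linarith)+
    then have "0 \<le> (1 - 2 * a) * ((u - y) + (1 - b) * y) + a * ((2 * u - x - 2 * y + t) + (1 - b) * (2 * y - t))"
      by (rule add_nonneg_nonneg)
    also have "\<dots> = u - a * x - b * y + a * b * t" by (simp add: algebra_simps)
    finally show ?thesis .
  qed
  consider "q2 \<le> 0" | "q1 \<le> 0" | "0 \<le> q1" "q1 \<le> 1 / 2" "0 \<le> q2" | "0 \<le> q2" "q2 \<le> 1 / 2" "0 \<le> q1"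
    | "1 / 2 \<le> q1" "1 / 2 \<le> q2" by linarith
  then show ?thesis
  proof cases
    case 1
    then show ?thesis using nonpos[of q1 q2 x y] assms by simp
  next
    case 2
    then show ?thesis using nonpos[of q2 q1 y x] assms by (simp add: mult_ac)
  next
    case 3
    then show ?thesis using small[of q1 q2 x y] assms by simp
  next
    case 4
    then show ?thesis using small[of q2 q1 y x] assms by (simp add: mult_ac)
  next
    case 5
    have "q1 * t \<le> 1 * \<bar>t\<bar>"
      using 5 q by (intro order_trans[OF _ mult_right_mono[of q1 1]] mult_left_mono) auto
    then have y: "0 \<le> y - q1 * t" using t by simp
    \<comment> \<open>On the curve, \<open>1 + q1\<close> times the form is quadratic in
      \<open>q1\<close> with leading coefficient \<open>- (x + t)\<close>. The first two products
      interpolate its values at 1/2 and 1, the third is the concavity excess, and the last pays for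
      moving \<open>q2\<close> onto the curve.\<close>
    have "0 \<le> (1 - q1) * (3 / 2) * (2 * u - x - 2 * y + t)" "0 \<le> (2 * q1 - 1) * (2 * u - 2 * x - y + t)"
      "0 \<le> (q1 - 1 / 2) * (1 - q1) * (x + t)" "0 \<le> (3 - (1 + q1) * (1 + q2)) * (y - q1 * t)"
      using 5 q t y ineq1 ineq2 by (intro mult_nonneg_nonneg; linarith)+
    then have "0 \<le> (1 - q1) * (3 / 2) * (2 * u - x - 2 * y + t) + (2 * q1 - 1) * (2 * u - 2 * x - y + t)
        + (q1 - 1 / 2) * (1 - q1) * (x + t) + (3 - (1 + q1) * (1 + q2)) * (y - q1 * t)"
      by linarith
    also have "\<dots> = (1 + q1) * (u - q1 * x - q2 * y + q1 * q2 * t)"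
      by (simp add: field_simps)
    finally show ?thesis using 5 by (simp add: zero_le_mult_iff)
  qed
qed

lemma qform_prod4_nonneg:
  assumes "- 1 \<le> q1" "q1 \<le> 1" "- 1 \<le> q2" "q2 \<le> 1" "(1 + q1) * (1 + q2) \<le> 3" "0 \<le> c"
  shows "0 \<le> qform (Q4 d) (kern c (- c * q1) (- c * q2) (c * (q1 * q2))) (\<lambda>(i, k, r, s). prod4 A B i k r s)"
proof -
  let ?w = "prod4 A B"
  \<comment> \<open>The mirrored vector supplies \<open>\<bar>t\<bar> \<le> x\<close>,
    \<open>y \<le> u\<close> and the second corner inequality.\<close>
  let ?w' = "prod4 (\<lambda>k i. cnj (A i k)) (\<lambda>s r. B r s)"
  note swap = form_prod4_swap[of d A B]
  have "0 \<le> form_1 d ?w - q1 * Re (form_F d ?w) - q2 * form_O d ?w + q1 * q2 * Re (form_FO d ?w)"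
    using form_O_FO_nonneg[of d ?w] form_O_FO_nonneg[of d ?w'] form_1_F_nonneg[of d ?w]
      form_1_F_nonneg[of d ?w'] form_prod4_ineq[of d A B]
      form_prod4_ineq[of d "\<lambda>k i. cnj (A i k)" "\<lambda>s r. B r s"]
    unfolding swap by (intro bilinear_form_nonneg assms(1-5)) linarith+
  then have "0 \<le> c * (form_1 d ?w - q1 * Re (form_F d ?w) - q2 * form_O d ?w + q1 * q2 * Re (form_FO d ?w))"
    using assms(6) by simp
  also have "\<dots> = c * form_1 d ?w + (- c * q1) * Re (form_F d ?w) + (- c * q2) * form_O d ?w
      + (c * (q1 * q2)) * Re (form_FO d ?w)"
    by (simp add: algebra_simps)
  finally show ?thesis unfolding qform_kern by (simp add: less_eq_complex_def)
qed

lemma sum_lessThan_supp2: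
  fixes f :: "nat \<Rightarrow> 'b :: comm_monoid_add"
  assumes "2 < d" "\<And>i. 2 \<le> i \<Longrightarrow> f i = 0"
  shows "(\<Sum>i<d. f i) = f 0 + f 1"
proof -
  have "2 \<le> i" if "i \<notin> {0, 1}" for i :: nat
    using that by (cases i) auto
  then have "(\<Sum>i<d. f i) = (\<Sum>i\<in>{0, 1}. f i)"
    using assms by (intro sum.mono_neutral_right) auto
  then show ?thesis by simp
qed

text \<open>The test pair is the identity and the symplectic form on a two-dimensional subspace.\<close>

lemma qform_prod4_witness:
  assumes "2 < d" "0 < c"
    and pos: "\<And>A B. 0 \<le> qform (Q4 d) (kern c (- c * q1) (- c * q2) (c * (q1 * q2)))
      (\<lambda>(i, k, r, s). prod4 A B i k r s)"
  shows "(1 + q1) * (1 + q2) \<le> 3"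
proof -
  define A B :: "nat \<Rightarrow> nat \<Rightarrow> complex"
    where "A i k = (if i < 2 \<and> k < 2 \<and> i = k then 1 else 0)"
      and "B r s = (if r = 0 \<and> s = 1 then 1 else if r = 1 \<and> s = 0 then - 1 else 0)" for i k r s
  have c: "contr d (prod4 A B) i r = (if i < 2 then B r i else 0)" for i r
    unfolding contr_def prod4_def
    by (subst sum_lessThan_supp2[OF assms(1)]) (auto simp: A_def B_def)
  have 1: "form_1 d (prod4 A B) = 4"
    unfolding form_1_def by (simp add: sum_lessThan_supp2[OF assms(1)] prod4_def A_def B_def)
  have 2: "Re (form_F d (prod4 A B)) = 2"
    unfolding form_F_prod4 by (simp add: sum_lessThan_supp2[OF assms(1)] A_def B_def)
  have 3: "form_O d (prod4 A B) = 2"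
    unfolding form_O_def c by (simp add: sum_lessThan_supp2[OF assms(1)] B_def)
  have 4: "Re (form_FO d (prod4 A B)) = - 2"
    unfolding form_FO_def c by (simp add: sum_lessThan_supp2[OF assms(1)] B_def)
  \<comment> \<open>With expectations 4, 2, 2 and -2 the form vanishes exactly on the curve
    \<open>(1 + q1) * (1 + q2) = 3\<close>.\<close>
  have "0 \<le> c * 4 + (- c * q1) * 2 + (- c * q2) * 2 + (c * (q1 * q2)) * (- 2)"
    using pos[of A B] unfolding qform_kern by (simp add: 1 2 3 4 less_eq_complex_def)
  also have "\<dots> = 2 * c * (3 - (1 + q1) * (1 + q2))" by (simp add: algebra_simps)
  finally show ?thesis using assms(2) by (simp add: zero_le_mult_iff)
qed

section \<open>Decomposition of kernels and its obstruction\<close>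

lemma kern_add: "kern x y z w a b + kern x' y' z' w' a b = kern (x + x') (y + y') (z + z') (w + w') a b"
  by (simp add: kern_def algebra_simps)

text \<open>For \<open>q2 \<le> 1 / d\<close> the kernel is itself psd, with eigenvalues
  \<open>c (1 \<mp> q1)\<close> and \<open>c (1 \<mp> q1) (1 - d q2)\<close>. Otherwise a multiple
  of the projection onto \<open>F = - 1\<close>, \<open>\<Omega> = 0\<close> is split off, and the
  rest is psd after partial transposition.\<close>

lemma kern_decomposition:
  assumes d: "2 < d" and c: "0 < c"
    and q: "- 1 \<le> q1" "q1 \<le> 1" "- 1 \<le> q2" "q2 \<le> 1"
    and s: "(1 + q1) * (1 + q2) \<le> 2 + 2 / real d"
  shows "\<exists>P Q. psd_kernel (Q4 d) P \<and> psd_kernel (Q4 d) (ptr Q) \<and>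
    (\<forall>a b. kern c (- c * q1) (- c * q2) (c * (q1 * q2)) a b = P a b + Q a b)"
proof (cases "q2 \<le> 1 / real d")
  case True
  have "d * q2 \<le> 1" using True d by (simp add: field_simps)
  then have "0 \<le> c * (1 - q1) * (1 - d * q2)" "0 \<le> c * (1 + q1) * (1 - d * q2)"
    "0 \<le> c * (1 - q1)" "0 \<le> c * (1 + q1)"
    using c q by simp_all
  then have "psd_kernel (Q4 d) (kern c (- c * q1) (- c * q2) (c * (q1 * q2)))"
    using d c q by (intro psd_kern) (simp_all add: algebra_simps)
  moreover have "psd_kernel (Q4 d) (ptr (kern 0 0 0 0))"
    using d by (intro psd_ptr_kern) simp_all
  ultimately show ?thesis
    by (intro exI[of _ "kern c (- c * q1) (- c * q2) (c * (q1 * q2))"] exI[of _ "kern 0 0 0 0"])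
      (simp add: kern_add)
next
  case False
  \<comment> \<open>The split-off part is \<open>c l (1 - F) (1 - \<Omega> / d)\<close>. This
    \<open>l\<close> makes the coefficients of \<open>1\<close> and \<Omega> in the remainder
    cancel; \<open>1 / d < q2 \<le> 1\<close> puts it into \<open>[0, 1]\<close>.\<close>
  define l where "l = d * (1 - q2) / (real d - 1)"
  have ld: "l * (real d - 1) = d * (1 - q2)" using d by (simp add: l_def)
  have dq: "1 < d * q2" using False d by (simp add: field_simps)
  have l: "0 \<le> l" "l \<le> 1" using d q dq by (auto simp: l_def field_simps)
  have ld': "l / d = l - (1 - q2)" using ld d by (simp add: field_simps)
  have lpos: "0 \<le> c * l" "0 \<le> c * (1 - l)" using c l by simp_all
  have "psd_kernel (Q4 d) (kern (c * l) (- (c * l)) (- (c * l) / d) (c * l / d))"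
    using d lpos by (intro psd_kern) (simp_all add: field_simps)
  moreover have "psd_kernel (Q4 d) (ptr (kern (c * (1 - l)) (c * (l - q1)) (c * (l / d - q2)) (c * (q1 * q2 - l / d))))"
  proof (rule psd_ptr_kern)
    have z: "l / d - q2 = - (1 - l)" using ld' by simp
    show "0 \<le> c * (1 - l) + c * (l / d - q2)" "0 \<le> c * (1 - l) - c * (l / d - q2)"
      unfolding z using lpos by (simp_all add: algebra_simps)
    have "l - q1 + (q1 * q2 - l / d) = (1 - q1) * (1 - q2)"
      unfolding ld' by (simp add: algebra_simps)
    then have e: "c * (l - q1) + c * (q1 * q2 - l / d) = c * ((1 - q1) * (1 - q2))"
      by (simp only: distrib_left[symmetric])
    show "0 \<le> c * (1 - l) + c * (l / d - q2) + d * (c * (l - q1) + c * (q1 * q2 - l / d))"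
    proof -
      have "0 \<le> d * (c * ((1 - q1) * (1 - q2)))" using c q by simp
      then show ?thesis unfolding z e by (simp add: algebra_simps)
    qed
    \<comment> \<open>The remaining eigenvalue is exactly \<open>c * d\<close> times the slack in
      the hypothesis \<open>s\<close>.\<close>
    have "0 \<le> c * (d * (2 + 2 / d - (1 + q1) * (1 + q2)))" using c s by simp
    also have "d * (2 + 2 / d - (1 + q1) * (1 + q2)) = 2 + d * (1 - q2) - d * q1 - d * (q1 * q2)"
      using d by (simp add: field_simps)
    also have "\<dots> = 2 * (1 - l) + (d * l - d * q1 - d * (q1 * q2) + l)"
      using ld by (simp add: algebra_simps)
    also have "c * \<dots> = c * (1 - l) - c * (l / d - q2) + d * (c * (l - q1) - c * (q1 * q2 - l / d))"
      unfolding z using d by (simp add: field_simps)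
    finally show "0 \<le> c * (1 - l) - c * (l / d - q2) + d * (c * (l - q1) - c * (q1 * q2 - l / d))" .
  qed (use d in simp)
  moreover have "kern c (- c * q1) (- c * q2) (c * (q1 * q2)) a b =
      kern (c * l) (- (c * l)) (- (c * l) / d) (c * l / d) a b
      + kern (c * (1 - l)) (c * (l - q1)) (c * (l / d - q2)) (c * (q1 * q2 - l / d)) a b" for a b
    unfolding kern_add by (rule arg_cong[of _ _ "\<lambda>f. f a b"]) (intro arg_cong4[where f = kern], simp_all add: algebra_simps)
  ultimately show ?thesis by blast
qed

text \<open>
  The witness is the (unnormalised) PPT state \<open>d 1 + d (F + \<Omega>) - (d + 2) F \<otimes> \<Omega>\<close>: it vanishes on the
  curve \<open>(1 + q\<^sub>1) (1 + q\<^sub>2) = 2 + 2 / d\<close> and is invariant under partial transposition up to exchanging the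
  tensor factors.
\<close>

lemma kern_no_decomposition:
  assumes d: "2 < d" and c: "0 < c"
    and P: "psd_kernel (Q4 d) P" and Q: "psd_kernel (Q4 d) Q"
    and eq: "\<And>a b. a \<in> Q4 d \<Longrightarrow> b \<in> Q4 d \<Longrightarrow>
      kern c (- c * q1) (- c * q2) (c * (q1 * q2)) a b = P a b + ptr Q a b"
  shows "(1 + q1) * (1 + q2) \<le> 2 + 2 / real d"
proof -
  define R where "R = kern d d d (- (real d + 2))"
  \<comment> \<open>The eigenvalues of \<open>R\<close> are \<open>2 d\<close>, 0, 0 and
    \<open>2 d (d + 1)\<close>; as \<open>F\<close> and \<Omega> have equal coefficients, the same
    holds for \<open>ptr R\<close>.\<close>
  have R: "psd_kernel (Q4 d) R" "psd_kernel (Q4 d) (ptr R)"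
    unfolding R_def using d by (auto intro!: psd_kern psd_ptr_kern simp: algebra_simps)
  have "pairing (Q4 d) (kern c (- c * q1) (- c * q2) (c * (q1 * q2))) R
      = pairing (Q4 d) P R + pairing (Q4 d) (ptr Q) R"
    unfolding pairing_def sum.distrib[symmetric]
  proof (intro sum.cong refl)
    fix a b assume "a \<in> Q4 d" "b \<in> Q4 d"
    then show "kern c (- c * q1) (- c * q2) (c * (q1 * q2)) b a * R a b = P b a * R a b + ptr Q b a * R a b"
      by (simp only: eq distrib_right)
  qed
  then have "0 \<le> pairing (Q4 d) (kern c (- c * q1) (- c * q2) (c * (q1 * q2))) R"
    using pairing_nonneg[OF _ P R(1)] pairing_nonneg[OF _ Q R(2)] by (simp add: pairing_ptr)
  \<comment> \<open>The last factor is \<open>2 d + 2 - d (1 + q1) (1 + q2)\<close>; the others are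
    positive.\<close>
  also have "pairing (Q4 d) (kern c (- c * q1) (- c * q2) (c * (q1 * q2))) R
      = of_real (c * d * d * (real d * d - 1) * (real d + 2 - d * q1 - d * q2 - d * (q1 * q2)))"
    unfolding R_def pairing_kern
    by (rule arg_cong[where f = of_real]) (simp add: algebra_simps power2_eq_square power3_eq_cube power4_eq_xxxx)
  finally have *: "0 \<le> c * d * d * (real d * d - 1) * (real d + 2 - d * q1 - d * q2 - d * (q1 * q2))"
    by (simp only: less_eq_complex_def) simp
  have "1 < real d * d" using d by (simp add: less_1_mult)
  then have "0 < c * d * d * (real d * d - 1)" using c d by simp
  with * have "0 \<le> real d + 2 - d * q1 - d * q2 - d * (q1 * q2)"
    by (simp only: zero_le_mult_iff) linarith
  then show ?thesis using d by (simp add: field_simps)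
qed

section \<open>Tensor products of Werner maps\<close>

text \<open>The pair consists of the flat input and output indices of a map on \<open>d * d\<close>
  matrices; each is split into its two tensor components.\<close>

definition split4 :: "nat \<Rightarrow> nat \<times> nat \<Rightarrow> idx4" where
  "split4 d = (\<lambda>(x, y). (x div d, x mod d, y div d, y mod d))"

definition join4 :: "nat \<Rightarrow> idx4 \<Rightarrow> nat \<times> nat" where
  "join4 d = (\<lambda>(i, k, r, s). (i * d + k, r * d + s))"

lemma split4_in: "a \<in> {..<d * d} \<times> {..<d * d} \<Longrightarrow> split4 d a \<in> Q4 d"
  by (cases "d = 0") (auto simp: split4_def less_mult_imp_div_less)

lemma join4_in: "a \<in> Q4 d \<Longrightarrow> join4 d a \<in> {..<d * d} \<times> {..<d * d}"
  by (auto simp: join4_def pair_index_less)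

lemma join4_split4 [simp]: "join4 d (split4 d a) = a"
  by (cases a) (simp add: join4_def split4_def)

lemma split4_join4: "a \<in> Q4 d \<Longrightarrow> split4 d (join4 d a) = a"
  by (auto simp: join4_def split4_def)

lemma psd_kernel_split4:
  assumes "psd_kernel (Q4 d) M"
  shows "psd_kernel ({..<d * d} \<times> {..<d * d}) (\<lambda>a b. M (split4 d a) (split4 d b))"
proof (rule psd_kernel_reindex)
  show "inj_on (split4 d) ({..<d * d} \<times> {..<d * d})"
    by (rule inj_on_inverseI[where g = "join4 d"]) simp
  show "psd_kernel (split4 d ` ({..<d * d} \<times> {..<d * d})) M"
    by (rule psd_kernel_subset[OF assms _ image_subsetI[OF split4_in]]) simp_all
qed

lemma psd_kernel_join4:
  assumes "psd_kernel ({..<d * d} \<times> {..<d * d}) C"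
  shows "psd_kernel (Q4 d) (\<lambda>a b. C (join4 d a) (join4 d b))"
proof (rule psd_kernel_reindex)
  show "inj_on (join4 d) (Q4 d)"
    by (rule inj_on_inverseI[where g = "split4 d"]) (rule split4_join4)
  show "psd_kernel (join4 d ` Q4 d) C"
    by (rule psd_kernel_subset[OF assms _ image_subsetI[OF join4_in]]) simp_all
qed

lemma qform_split4:
  "qform ({..<d * d} \<times> {..<d * d}) (\<lambda>a b. M (split4 d a) (split4 d b)) v
    = qform (Q4 d) M (\<lambda>a. v (join4 d a))"
proof -
  have 1: "sum f ({..<d * d} \<times> {..<d * d}) = (\<Sum>a\<in>Q4 d. f (join4 d a))" for f :: "nat \<times> nat \<Rightarrow> complex"
    unfolding sum.cartesian_product' sum_mult_index by (simp add: join4_def)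
  show ?thesis unfolding qform_def 1 by (intro sum.cong refl) (simp only: split4_join4)
qed

text \<open>Separates the translation of positivity and decomposability into four-index kernels from
  the computation of the kernel for Werner maps.\<close>

locale split_map =
  fixes d :: nat and T :: "complex mat \<Rightarrow> complex mat" and M :: "idx4 \<Rightarrow> idx4 \<Rightarrow> complex"
  assumes lin: "linear_map (d * d) (d * d) T"
    and ker: "\<And>a b. a \<in> {..<d * d} \<times> {..<d * d} \<Longrightarrow> b \<in> {..<d * d} \<times> {..<d * d} \<Longrightarrow>
      map_kernel (d * d) T a b = M (split4 d a) (split4 d b)"
begin

lemma eq_kmap:
  assumes "X \<in> carrier_mat (d * d) (d * d)"
  shows "T X = kmap (d * d) (\<lambda>a b. M (split4 d a) (split4 d b)) X"
  unfolding linear_map_eq_kmap[OF lin assms] kmap_def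
  by (intro eq_matI) (simp_all add: ker)

lemma positive_iff:
  "positive_map (d * d) (d * d) T \<longleftrightarrow>
    (\<forall>A B. 0 \<le> qform (Q4 d) M (\<lambda>(i, k, r, s). prod4 A B i k r s))"
proof -
  let ?K = "kmap (d * d) (\<lambda>a b. M (split4 d a) (split4 d b))"
  have "positive_map (d * d) (d * d) T \<longleftrightarrow> positive_map (d * d) (d * d) ?K"
    using lin eq_kmap by (auto simp: positive_map_def linear_map_kmap psd_def)
  also have "\<dots> \<longleftrightarrow> (\<forall>a v. 0 \<le> qform (Q4 d) M (\<lambda>x. case join4 d x of (i, r) \<Rightarrow> cnj (a i) * v r))"
    unfolding positive_map_kmap qform_split4 ..
  also have "\<dots> \<longleftrightarrow> (\<forall>A B. 0 \<le> qform (Q4 d) M (\<lambda>(i, k, r, s). prod4 A B i k r s))"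
  proof (intro iffI allI)
    fix A B
    assume *: "\<forall>a v. 0 \<le> qform (Q4 d) M (\<lambda>x. case join4 d x of (i, r) \<Rightarrow> cnj (a i) * v r)"
    have "qform (Q4 d) M (\<lambda>x. case join4 d x of (i, r) \<Rightarrow> cnj (A (i div d) (i mod d)) * B (r div d) (r mod d))
        = qform (Q4 d) M (\<lambda>(i, k, r, s). prod4 A B i k r s)"
      unfolding qform_def by (intro sum.cong refl) (auto simp: join4_def prod4_def)
    with *[rule_format, of "\<lambda>i. A (i div d) (i mod d)" "\<lambda>r. B (r div d) (r mod d)"]
    show "0 \<le> qform (Q4 d) M (\<lambda>(i, k, r, s). prod4 A B i k r s)" by simp
  next
    fix a v
    assume *: "\<forall>A B. 0 \<le> qform (Q4 d) M (\<lambda>(i, k, r, s). prod4 A B i k r s)"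
    have "(\<lambda>x. case join4 d x of (i, r) \<Rightarrow> cnj (a i) * v r)
        = (\<lambda>(i, k, r, s). prod4 (\<lambda>i k. a (i * d + k)) (\<lambda>r s. v (r * d + s)) i k r s)"
      by (auto simp: join4_def prod4_def)
    with * show "0 \<le> qform (Q4 d) M (\<lambda>x. case join4 d x of (i, r) \<Rightarrow> cnj (a i) * v r)" by simp
  qed
  finally show ?thesis .
qed

text \<open>Choi's theorem turns both summands into psd kernels, and transposing the output of a map
  acts on its kernel as \<open>ptr\<close>.\<close>

lemma decomposable_iff:
  "decomposable (d * d) (d * d) T \<longleftrightarrow> (\<exists>P Q. psd_kernel (Q4 d) P \<and> psd_kernel (Q4 d) Q \<and>
    (\<forall>a\<in>Q4 d. \<forall>b\<in>Q4 d. M a b = P a b + ptr Q a b))"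
proof
  assume "\<exists>P Q. psd_kernel (Q4 d) P \<and> psd_kernel (Q4 d) Q \<and>
    (\<forall>a\<in>Q4 d. \<forall>b\<in>Q4 d. M a b = P a b + ptr Q a b)"
  then obtain P Q where PQ: "psd_kernel (Q4 d) P" "psd_kernel (Q4 d) Q"
    and M: "\<And>a b. a \<in> Q4 d \<Longrightarrow> b \<in> Q4 d \<Longrightarrow> M a b = P a b + ptr Q a b" by blast
  define T1 T2 where "T1 = kmap (d * d) (\<lambda>a b. P (split4 d a) (split4 d b))"
    and "T2 = kmap (d * d) (\<lambda>a b. Q (split4 d a) (split4 d b))"
  have "T X = T1 X + transpose_mat (T2 X)" if X: "X \<in> carrier_mat (d * d) (d * d)" for X
  proof (rule eq_matI)
    fix r c assume "r < dim_row (T1 X + transpose_mat (T2 X))" "c < dim_col (T1 X + transpose_mat (T2 X))"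
    then have rc: "r < d * d" "c < d * d" by (simp_all add: T1_def T2_def kmap_def)
    have "M (split4 d (i, r)) (split4 d (j, c))
        = P (split4 d (i, r)) (split4 d (j, c)) + Q (split4 d (i, c)) (split4 d (j, r))"
      if "i < d * d" "j < d * d" for i j
      using M[OF split4_in[of "(i, r)"] split4_in[of "(j, c)"]] that rc
      by (simp add: ptr_def split4_def)
    then show "T X $$ (r, c) = (T1 X + transpose_mat (T2 X)) $$ (r, c)"
      unfolding eq_kmap[OF X] T1_def T2_def kmap_def using rc
      by (simp add: distrib_left sum.distrib)
  qed (simp_all add: eq_kmap[OF X] T1_def T2_def kmap_def)
  moreover have "completely_positive (d * d) (d * d) T1" "completely_positive (d * d) (d * d) T2"
    unfolding T1_def T2_def by (rule completely_positive_kmap[OF psd_kernel_split4], fact)+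
  ultimately show "decomposable (d * d) (d * d) T" unfolding decomposable_def by blast
next
  assume "decomposable (d * d) (d * d) T"
  then obtain T1 T2 where cp: "completely_positive (d * d) (d * d) T1" "completely_positive (d * d) (d * d) T2"
    and T: "\<And>X. X \<in> carrier_mat (d * d) (d * d) \<Longrightarrow> T X = T1 X + transpose_mat (T2 X)"
    unfolding decomposable_def by blast
  have car: "T1 X \<in> carrier_mat (d * d) (d * d)" "T2 X \<in> carrier_mat (d * d) (d * d)"
    if "X \<in> carrier_mat (d * d) (d * d)" for X
    using cp that by (auto simp: completely_positive_def linear_map_def)
  define P Q where "P a b = map_kernel (d * d) T1 (join4 d a) (join4 d b)"
    and "Q a b = map_kernel (d * d) T2 (join4 d a) (join4 d b)" for a b
  have "M a b = P a b + ptr Q a b" if ab: "a \<in> Q4 d" "b \<in> Q4 d" for a b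
  proof -
    obtain i k r s where a: "a = (i, k, r, s)" by (cases a)
    obtain j l t u where b: "b = (j, l, t, u)" by (cases b)
    have bd: "i * d + k < d * d" "r * d + s < d * d" "j * d + l < d * d" "t * d + u < d * d"
      using ab by (auto simp: a b pair_index_less)
    have "M a b = map_kernel (d * d) T (join4 d a) (join4 d b)"
      using ker[OF join4_in[OF ab(1)] join4_in[OF ab(2)]] ab by (simp only: split4_join4)
    also have "\<dots> = P a b + ptr Q a b"
      using bd carrier_matD[OF car(1)[OF mat_unit_carrier]] carrier_matD[OF car(2)[OF mat_unit_carrier]]
      by (simp add: a b P_def Q_def ptr_def join4_def map_kernel_def T[OF mat_unit_carrier])
    finally show ?thesis .
  qed
  moreover have "psd_kernel (Q4 d) P" "psd_kernel (Q4 d) Q"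
    unfolding P_def Q_def by (rule psd_kernel_join4[OF psd_map_kernel], fact)+
  ultimately show "\<exists>P Q. psd_kernel (Q4 d) P \<and> psd_kernel (Q4 d) Q \<and>
    (\<forall>a\<in>Q4 d. \<forall>b\<in>Q4 d. M a b = P a b + ptr Q a b)"
    by (intro exI[of _ P] exI[of _ Q]) (intro conjI ballI)
qed

end

text \<open>The Werner map is \<open>X \<mapsto> \<alpha> (tr X 1 - q X\<^sup>T)\<close> for the following \<open>\<alpha>\<close> and \<open>q\<close>.\<close>

definition werner_scale :: "nat \<Rightarrow> real \<Rightarrow> real" where
  "werner_scale d p = (real d + 1 - 2 * p) / (real d * (real d + 1) * (real d - 1))"

definition werner_ratio :: "nat \<Rightarrow> real \<Rightarrow> real" where
  "werner_ratio d p = (real d + 1 - 2 * p * real d) / (real d + 1 - 2 * p)"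

text \<open>In the Choi matrix the identity encodes the map \<open>X \<mapsto> tr X 1\<close> and
  the flip encodes transposition; the two coefficients are read off the Werner state.\<close>

lemma werner_map_mat_unit:
  assumes d: "2 < d" and p: "p \<in> {0..1}" and W: "is_werner_map d p W"
    and b: "i < d" "j < d" "k < d" "l < d"
  shows "W (mat_unit d i j) $$ (k, l) = of_real (werner_scale d p) *
    (of_bool (i = j \<and> k = l) - of_real (werner_ratio d p) * of_bool (i = l \<and> j = k))"
proof -
  have fl: "i * d + k = l * d + j \<longleftrightarrow> i = l \<and> k = j"
  proof
    assume "i * d + k = l * d + j"
    then have "(i * d + k) div d = (l * d + j) div d" "(i * d + k) mod d = (l * d + j) mod d" by simp_all
    then show "i = l \<and> k = j" using b by simp
  qed simp
  have "W (mat_unit d i j) $$ (k, l) = werner_state d p $$ (i * d + k, j * d + l)"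
    using index_choi[of d W i j k l] W b by (simp add: is_werner_map_def)
  also have "\<dots> = of_real (p / d_sym d) * (1 / 2 * (of_bool (i = j \<and> k = l) + of_bool (i = l \<and> j = k)))
      + of_real ((1 - p) / d_asym d) * (1 / 2 * (of_bool (i = j \<and> k = l) - of_bool (i = l \<and> j = k)))"
    using b d fl
    by (auto simp: werner_state_def P_sym_def P_asym_def flip_mat_def pair_index_less kron_def)
  also have "\<dots> = of_real ((p / d_sym d + (1 - p) / d_asym d) / 2) * of_bool (i = j \<and> k = l)
      + of_real ((p / d_sym d - (1 - p) / d_asym d) / 2) * of_bool (i = l \<and> j = k)"
    by (simp add: algebra_simps add_divide_distrib diff_divide_distrib)
  also have "(p / d_sym d + (1 - p) / d_asym d) / 2 = werner_scale d p"
    using d by (simp add: d_sym_def d_asym_def werner_scale_def divide_simps) (simp add: algebra_simps)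
  also have "(p / d_sym d - (1 - p) / d_asym d) / 2 = - werner_scale d p * werner_ratio d p"
  proof -
    have "real d + 1 - 2 * p \<noteq> 0" using d p by auto
    then have "werner_scale d p * werner_ratio d p = (real d + 1 - 2 * p * d) / (real d * (real d + 1) * (real d - 1))"
      by (simp add: werner_scale_def werner_ratio_def)
    then show ?thesis
      using d by (simp add: d_sym_def d_asym_def divide_simps) (simp add: algebra_simps)
  qed
  finally show ?thesis by (simp add: algebra_simps)
qed

text \<open>The transposition on the second factor turns its flip into \<Omega>, so the Choi kernel
  is \<open>c (1 - q1 F) (1 - q2 \<Omega>)\<close>.\<close>

lemma split_map_werner:
  assumes d: "2 < d" and p: "p1 \<in> {0..1}" "p2 \<in> {0..1}"
    and W: "is_werner_map d p1 W1" "is_werner_map d p2 W2"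
  defines "c \<equiv> werner_scale d p1 * werner_scale d p2"
    and "q1 \<equiv> werner_ratio d p1" and "q2 \<equiv> werner_ratio d p2"
  shows "split_map d (tensor_map d d d d W1 (transpose_mat \<circ> W2))
    (kern c (- c * q1) (- c * q2) (c * (q1 * q2)))"
proof
  show "linear_map (d * d) (d * d) (tensor_map d d d d W1 (transpose_mat \<circ> W2))"
    by (rule linear_map_tensor_map)
  have lin1: "linear_map d d W1" and lin2: "linear_map d d W2"
    using W by (simp_all add: is_werner_map_def)
  have lin2': "linear_map d d (transpose_mat \<circ> W2)"
  proof -
    have "transpose_mat (A + B) = transpose_mat A + transpose_mat B"
      if "A \<in> carrier_mat d d" "B \<in> carrier_mat d d" for A B :: "complex mat"
      using that by (intro eq_matI) auto
    moreover have "transpose_mat (a \<cdot>\<^sub>m A) = a \<cdot>\<^sub>m transpose_mat A" for a and A :: "complex mat"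
      by (intro eq_matI) auto
    ultimately show ?thesis using lin2 by (simp add: linear_map_def)
  qed
  have car: "W1 (mat_unit d i j) \<in> carrier_mat d d" "W2 (mat_unit d i j) \<in> carrier_mat d d"
    "(transpose_mat \<circ> W2) (mat_unit d i j) \<in> carrier_mat d d" for i j
    using lin1 lin2 by (auto simp: linear_map_def)
  fix a b assume ab: "a \<in> {..<d * d} \<times> {..<d * d}" "b \<in> {..<d * d} \<times> {..<d * d}"
  obtain i k r s where a': "split4 d a = (i, k, r, s)" by (cases "split4 d a")
  obtain j l t u where b': "split4 d b = (j, l, t, u)" by (cases "split4 d b")
  have bd: "i < d" "k < d" "r < d" "s < d" "j < d" "l < d" "t < d" "u < d"
    using split4_in[OF ab(1)] split4_in[OF ab(2)] by (auto simp: a' b')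
  have a: "a = (i * d + k, r * d + s)" using join4_split4[of d a] by (simp add: a' join4_def)
  have b: "b = (j * d + l, t * d + u)" using join4_split4[of d b] by (simp add: b' join4_def)
  have unit: "mat_unit (d * d) (i * d + k) (j * d + l) = kron (mat_unit d i j) (mat_unit d k l)"
  proof (rule eq_matI)
    fix x y assume "x < dim_row (kron (mat_unit d i j) (mat_unit d k l))"
      "y < dim_col (kron (mat_unit d i j) (mat_unit d k l))"
    then have xy: "x < d * d" "y < d * d" by (simp_all add: kron_def)
    have div_mod: "z = i * d + k \<longleftrightarrow> z div d = i \<and> z mod d = k" if "k < d" for z i k
      using that by auto
    show "mat_unit (d * d) (i * d + k) (j * d + l) $$ (x, y) = kron (mat_unit d i j) (mat_unit d k l) $$ (x, y)"
      using xy bd d by (auto simp: kron_def less_mult_imp_div_less div_mod)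
  qed (simp_all add: kron_def)
  have "map_kernel (d * d) (tensor_map d d d d W1 (transpose_mat \<circ> W2)) a b
      = kron (W1 (mat_unit d i j)) ((transpose_mat \<circ> W2) (mat_unit d k l)) $$ (r * d + s, t * d + u)"
    by (simp only: a b map_kernel_def unit tensor_map_kron[OF lin1 lin2' mat_unit_carrier mat_unit_carrier] prod.case)
  also have "\<dots> = W1 (mat_unit d i j) $$ (r, t) * W2 (mat_unit d k l) $$ (u, s)"
    using bd car(2)[of k l] by (simp add: index_kron[OF car(1) car(3)[unfolded o_apply]] pair_index_less)
  also have "\<dots> = of_real c * ((of_bool (i = j \<and> r = t) - of_real q1 * of_bool (i = t \<and> j = r))
      * (of_bool (k = l \<and> u = s) - of_real q2 * of_bool (k = s \<and> l = u)))"
    using werner_map_mat_unit[OF d p(1) W(1), of i j r t] werner_map_mat_unit[OF d p(2) W(2), of k l u s] bd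
    by (simp add: c_def q1_def q2_def mult_ac)
  also have "\<dots> = kern c (- c * q1) (- c * q2) (c * (q1 * q2)) (split4 d a) (split4 d b)"
    by (simp add: a' b' kern_def of_bool_conj algebra_simps eq_commute[of u s])
  finally show "map_kernel (d * d) (tensor_map d d d d W1 (transpose_mat \<circ> W2)) a b
      = kern c (- c * q1) (- c * q2) (c * (q1 * q2)) (split4 d a) (split4 d b)" .
qed

theorem theorem6p2:
  fixes d :: nat and p1 p2 :: real and W1 W2 :: "complex mat \<Rightarrow> complex mat"
  assumes "2 < d"
    and "p1 \<in> {0..1}" and "p2 \<in> {0..1}"
    and "is_werner_map d p1 W1" and "is_werner_map d p2 W2"
  shows "(positive_map (d * d) (d * d) (tensor_map d d d d W1 (transpose_mat \<circ> W2)) \<and>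
          \<not> decomposable (d * d) (d * d) (tensor_map d d d d W1 (transpose_mat \<circ> W2)))
    \<longleftrightarrow>
      (0 \<le> - (((real d + 1 - 2 * p1 * real d) * (real d + 1 - 2 * p2 * real d)) /
              ((real d + 1 - 2 * p1) * (real d + 1 - 2 * p2)))
            - ((real d + 1 - 2 * p1 * real d) / (real d + 1 - 2 * p1)
               + (real d + 1 - 2 * p2 * real d) / (real d + 1 - 2 * p2))
            + 2 \<and>
       (real d - 1) / (real d + 1) * p1 * p2 + p1 * (1 - p2) + (1 - p1) * p2
         - (1 - p1) * (1 - p2) < 0)"
proof -
  define c q1 q2 where "c = werner_scale d p1 * werner_scale d p2"
    and "q1 = werner_ratio d p1" and "q2 = werner_ratio d p2"
  interpret split_map d "tensor_map d d d d W1 (transpose_mat \<circ> W2)"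
    "kern c (- c * q1) (- c * q2) (c * (q1 * q2))"
    unfolding c_def q1_def q2_def by (rule split_map_werner) fact+
  have scale: "0 < werner_scale d p" if "p \<in> {0..1}" for p
    using that assms(1) by (simp add: werner_scale_def)
  then have c: "0 < c" using assms(2,3) by (simp add: c_def)
  have ratio: "1 + werner_ratio d p = 2 * (real d + 1) * (1 - p) / (real d + 1 - 2 * p)"
    "1 - werner_ratio d p = 2 * (real d - 1) * p / (real d + 1 - 2 * p)"
    "0 < real d + 1 - 2 * p" if "p \<in> {0..1}" for p
    using that assms(1) by (simp_all add: werner_ratio_def field_simps)
  have "0 \<le> 1 + werner_ratio d p" "0 \<le> 1 - werner_ratio d p" if "p \<in> {0..1}" for p
    unfolding ratio[OF that] using that assms(1) by (auto intro!: divide_nonneg_nonneg)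
  from this[OF assms(2)] this[OF assms(3)]
  have q: "- 1 \<le> q1" "q1 \<le> 1" "- 1 \<le> q2" "q2 \<le> 1" by (simp_all add: q1_def q2_def)
  have pos: "positive_map (d * d) (d * d) (tensor_map d d d d W1 (transpose_mat \<circ> W2))
      \<longleftrightarrow> (1 + q1) * (1 + q2) \<le> 3"
    unfolding positive_iff using qform_prod4_nonneg[OF q] qform_prod4_witness[OF assms(1) c] c
    by (metis less_imp_le)
  have dec: "decomposable (d * d) (d * d) (tensor_map d d d d W1 (transpose_mat \<circ> W2))
      \<longleftrightarrow> (1 + q1) * (1 + q2) \<le> 2 + 2 / real d"
  proof
    assume "decomposable (d * d) (d * d) (tensor_map d d d d W1 (transpose_mat \<circ> W2))"
    then show "(1 + q1) * (1 + q2) \<le> 2 + 2 / real d"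
      unfolding decomposable_iff using kern_no_decomposition[OF assms(1) c] by blast
  next
    assume "(1 + q1) * (1 + q2) \<le> 2 + 2 / real d"
    from kern_decomposition[OF assms(1) c q this] obtain P Q
      where *: "psd_kernel (Q4 d) P" "psd_kernel (Q4 d) (ptr Q)"
        "\<And>a b. kern c (- c * q1) (- c * q2) (c * (q1 * q2)) a b = P a b + Q a b" by blast
    \<comment> \<open>The decomposition makes \<open>ptr Q\<close> psd, whereas
      \<open>decomposable_iff\<close> wants the psd kernel under \<open>ptr\<close>.\<close>
    have "ptr (ptr Q) = Q" by (auto simp: ptr_def fun_eq_iff)
    with * show "decomposable (d * d) (d * d) (tensor_map d d d d W1 (transpose_mat \<circ> W2))"
      unfolding decomposable_iff by metis
  qed
  define D1 D2 where "D1 = real d + 1 - 2 * p1" and "D2 = real d + 1 - 2 * p2"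
  have D: "0 < D1" "0 < D2" using ratio(3) assms(2,3) by (simp_all add: D1_def D2_def)
  have "(1 + q1) * (1 + q2) \<le> 3 \<longleftrightarrow> 0 \<le> - (q1 * q2) - (q1 + q2) + 2"
    by (simp add: algebra_simps)
  moreover have "(1 + q1) * (1 + q2) \<le> 2 + 2 / real d \<longleftrightarrow> \<not>
     (real d - 1) / (real d + 1) * p1 * p2 + p1 * (1 - p2) + (1 - p1) * p2 - (1 - p1) * (1 - p2) < 0"
    (is "_ \<longleftrightarrow> \<not> ?E < 0")
  proof -
    have "(1 + q1) * (1 + q2) = 4 * (real d + 1) * (real d + 1) * ((1 - p1) * (1 - p2)) / (D1 * D2)"
      unfolding q1_def q2_def ratio(1)[OF assms(2)] ratio(1)[OF assms(3)] D1_def D2_def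
      by simp (simp add: algebra_simps)
    moreover have "2 + 2 / real d = 2 * (real d + 1) / d" using assms(1) by (simp add: field_simps)
    ultimately have "(1 + q1) * (1 + q2) \<le> 2 + 2 / real d \<longleftrightarrow>
        4 * (real d + 1) * (real d + 1) * ((1 - p1) * (1 - p2)) / (D1 * D2) \<le> 2 * (real d + 1) / d"
      by (simp only:)
    also have "\<dots> \<longleftrightarrow>
        4 * (real d + 1) * (real d + 1) * ((1 - p1) * (1 - p2)) * d \<le> 2 * (real d + 1) * (D1 * D2)"
      using D assms(1) by (subst pos_divide_le_eq, simp) (subst times_divide_eq_left, subst pos_le_divide_eq, simp_all)
    also have "4 * (real d + 1) * (real d + 1) * ((1 - p1) * (1 - p2)) * d
        = 2 * (real d + 1) * (2 * d * (real d + 1) * ((1 - p1) * (1 - p2)))"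
      by simp
    also have "2 * (real d + 1) * (2 * d * (real d + 1) * ((1 - p1) * (1 - p2))) \<le> 2 * (real d + 1) * (D1 * D2)
        \<longleftrightarrow> 2 * d * (real d + 1) * ((1 - p1) * (1 - p2)) \<le> D1 * D2"
      by (rule mult_le_cancel_left_pos) simp
    also have "\<dots> \<longleftrightarrow> 0 \<le> (real d - 1) * ((real d + 1) * ?E)"
    proof -
      have "(real d + 1) * ?E = (real d - 1) * p1 * p2
          + (real d + 1) * (p1 * (1 - p2) + (1 - p1) * p2 - (1 - p1) * (1 - p2))"
        by (simp add: divide_simps) (simp add: algebra_simps)
      \<comment> \<open>This identity matches the threshold for \<open>(1 + q1) * (1 + q2)\<close>
        with the sign of the second expression of the theorem.\<close>
      then have "D1 * D2 - 2 * d * (real d + 1) * ((1 - p1) * (1 - p2)) = (real d - 1) * ((real d + 1) * ?E)"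
        by (simp only: D1_def D2_def) (simp add: algebra_simps)
      then show ?thesis by linarith
    qed
    also have "\<dots> \<longleftrightarrow> 0 \<le> ?E"
      using assms(1) by (simp add: zero_le_mult_iff)
    finally show ?thesis by linarith
  qed
  ultimately show ?thesis
    unfolding pos dec q1_def q2_def werner_ratio_def times_divide_times_eq by simp
qed

end
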